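(* Let $G=E_7$ be the simply connected compact Lie group of type $E_7$, let $m$ be a positive integer and $p$ a prime. Write $m=p^i m'$ with $p\nmid m'$. (1) If $p=2$, then $N(E_7,m,2)$ is the number of tuples $(b_1,\dots,b_7)\in\frac{1}{\sqrt2}\mathbb{Z}\times\left(\mathbb{Z}^6\cup(\mathbb{Z}+\frac12)^6\right)$ such that $$b_2>\dots>b_6>|b_7|,\quad \sqrt2\,b_1>b_2+\dots+b_6-b_7,\quad p^i>\sqrt2\,b_1,$$ $$2\mid(\sqrt2\,b_1+b_2+\dots+b_6-b_7).$$ (2) If $p>2$, then $N(E_7,m,p)$ is the number of tuples $(b_1,\dots,b_7)\in\frac{1}{\sqrt2}\mathbb{Z}\times\left(\mathbb{Z}^6\cup(\mathbb{Z}+\frac12)^6\right)$ with $2b_j\equiv\sqrt2\,b_1 \pmod 2$ for $j=2,\dots,7$, such that $$b_2>\dots>b_6>|b_7|,\quad \sqrt2\,b_1>b_2+\dots+b_6-b_7,\quad p^i>\sqrt2\,b_1,\quad 2\mid(b_2+\dots+b_7).$$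
   Context: Let $G$ be a simply connected simple compact Lie group with maximal torus $T$ and weight lattice $\Pi^*=\mathrm{Hom}(T,S^1)$. $\langle\cdot,\cdot\rangle$ is the unique Weyl-invariant inner product on $\Pi^*$ (extended to $\Pi^*\otimes\mathbb{R}$) with $\langle u,u\rangle=2$ for all long roots $u$ (in the simply laced case all roots are long). The fundamental Weyl chamber $V\subset\Pi^*\otimes\mathbb{R}$ is the set of points having non-negative inner product with all positive roots; $\theta$ is the highest root. The level $m$ fundamental alcove is $A=\{x\in V:\langle\theta,x\rangle\le m\}$. A level $m$ regular weight is an element of $\Pi^*$ in the interior of $A$. $N(G,m,p)$ denotes the number of level $m$ regular weights $a$ such that for every weight $w\in\Pi^*$ the denominator (in lowest terms) of the rational number $\langle w,a\rangle/m$ is a power $p^k$, $k\ge0$, of $p$. *)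

theory Defs
  imports
    "HOL-Analysis.Analysis"
    "HOL-Library.Real_Mod"
    "HOL-Computational_Algebra.Primes"
begin

text \<open>
  A simply connected simple compact Lie group \<open>G\<close> with maximal torus \<open>T\<close> is represented by its
  root system \<open>\<Phi>\<close> and a base \<open>\<Delta>\<close> of \<open>\<Phi>\<close>. The ambient Euclidean space
  is \<open>\<Pi>\<^sup>* \<otimes> \<real>\<close>, and its inner product is the normalised Weyl-invariant one; the Lie algebra of
  \<open>T\<close> is identified with this space by means of the inner product. Characters of \<open>T\<close> are
  identified with their differentials divided by \<open>2 \<pi> i\<close>.
\<close>

definition coroot :: "'a::euclidean_space \<Rightarrow> 'a" where
  "coroot \<alpha> = (2 / (\<alpha> \<bullet> \<alpha>)) *\<^sub>R \<alpha>"

definition root_reflection :: "'a::euclidean_space \<Rightarrow> 'a \<Rightarrow> 'a" where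
  "root_reflection \<alpha> x = x - (x \<bullet> coroot \<alpha>) *\<^sub>R \<alpha>"

definition root_system :: "'a::euclidean_space set \<Rightarrow> bool" where
  "root_system \<Phi> \<longleftrightarrow>
     finite \<Phi> \<and> 0 \<notin> \<Phi> \<and> span \<Phi> = UNIV \<and>
     (\<forall>\<alpha>\<in>\<Phi>. root_reflection \<alpha> ` \<Phi> = \<Phi>) \<and>
     (\<forall>\<alpha>\<in>\<Phi>. \<forall>\<beta>\<in>\<Phi>. \<beta> \<bullet> coroot \<alpha> \<in> \<int>) \<and>
     (\<forall>\<alpha>\<in>\<Phi>. \<forall>c. c *\<^sub>R \<alpha> \<in> \<Phi> \<longrightarrow> c = 1 \<or> c = -1)"

definition irreducible_roots :: "'a::euclidean_space set \<Rightarrow> bool" where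
  "irreducible_roots \<Phi> \<longleftrightarrow>
     \<Phi> \<noteq> {} \<and>
     (\<forall>A B. \<Phi> = A \<union> B \<and> (\<forall>\<alpha>\<in>A. \<forall>\<beta>\<in>B. \<alpha> \<bullet> \<beta> = 0) \<longrightarrow> A = {} \<or> B = {})"

definition nonneg_combinations :: "'a::euclidean_space set \<Rightarrow> 'a set" where
  "nonneg_combinations \<Delta> = {\<Sum>\<alpha>\<in>\<Delta>. real (c \<alpha>) *\<^sub>R \<alpha> | c :: 'a \<Rightarrow> nat. True}"

definition base_of :: "'a::euclidean_space set \<Rightarrow> 'a set \<Rightarrow> bool" where
  "base_of \<Phi> \<Delta> \<longleftrightarrow>
     \<Delta> \<subseteq> \<Phi> \<and> independent \<Delta> \<and>
     (\<forall>\<beta>\<in>\<Phi>. \<beta> \<in> nonneg_combinations \<Delta> \<or> - \<beta> \<in> nonneg_combinations \<Delta>)"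

definition long_root :: "'a::euclidean_space set \<Rightarrow> 'a \<Rightarrow> bool" where
  "long_root \<Phi> u \<longleftrightarrow> u \<in> \<Phi> \<and> (\<forall>v\<in>\<Phi>. norm v \<le> norm u)"

text \<open>
  Irreducibility corresponds to \<open>G\<close> being simple. The last condition normalises the inner
  product, which is automatically Weyl-invariant since reflections are orthogonal.
\<close>

definition simple_root_datum :: "'a::euclidean_space set \<Rightarrow> 'a set \<Rightarrow> bool" where
  "simple_root_datum \<Phi> \<Delta> \<longleftrightarrow>
     root_system \<Phi> \<and> irreducible_roots \<Phi> \<and> base_of \<Phi> \<Delta> \<and>
     (\<forall>u. long_root \<Phi> u \<longrightarrow> u \<bullet> u = 2)"

definition positive_roots :: "'a::euclidean_space set \<Rightarrow> 'a set \<Rightarrow> 'a set" where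
  "positive_roots \<Phi> \<Delta> = \<Phi> \<inter> nonneg_combinations \<Delta>"

definition highest_root :: "'a::euclidean_space set \<Rightarrow> 'a set \<Rightarrow> 'a" where
  "highest_root \<Phi> \<Delta> = (THE \<theta>. \<theta> \<in> \<Phi> \<and> (\<forall>\<beta>\<in>\<Phi>. \<theta> - \<beta> \<in> nonneg_combinations \<Delta>))"

text \<open>
  Since \<open>G\<close> is simply connected, the kernel of the exponential map of \<open>T\<close> (rescaled
  by \<open>2 \<pi>\<close>) is the lattice spanned by the coroots, so that \<open>Hom(T, S\<^sup>1)\<close> consists of
  the linear forms that are integral on this lattice.
\<close>

definition coroot_lattice :: "'a::euclidean_space set \<Rightarrow> 'a set" where
  "coroot_lattice \<Phi> = {\<Sum>\<alpha>\<in>\<Phi>. of_int (c \<alpha>) *\<^sub>R coroot \<alpha> | c :: 'a \<Rightarrow> int. True}"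

definition weight_lattice :: "'a::euclidean_space set \<Rightarrow> 'a set" where
  "weight_lattice \<Phi> = {x. \<forall>v\<in>coroot_lattice \<Phi>. x \<bullet> v \<in> \<int>}"

definition weyl_chamber :: "'a::euclidean_space set \<Rightarrow> 'a set \<Rightarrow> 'a set" where
  "weyl_chamber \<Phi> \<Delta> = {x. \<forall>\<alpha>\<in>positive_roots \<Phi> \<Delta>. 0 \<le> x \<bullet> \<alpha>}"

definition alcove :: "'a::euclidean_space set \<Rightarrow> 'a set \<Rightarrow> nat \<Rightarrow> 'a set" where
  "alcove \<Phi> \<Delta> m = {x \<in> weyl_chamber \<Phi> \<Delta>. highest_root \<Phi> \<Delta> \<bullet> x \<le> real m}"

definition regular_weights :: "'a::euclidean_space set \<Rightarrow> 'a set \<Rightarrow> nat \<Rightarrow> 'a set" where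
  "regular_weights \<Phi> \<Delta> m = weight_lattice \<Phi> \<inter> interior (alcove \<Phi> \<Delta> m)"

definition denominator_is_power :: "real \<Rightarrow> nat \<Rightarrow> bool" where
  "denominator_is_power x p \<longleftrightarrow>
     (\<exists>q k. x = of_rat q \<and> snd (quotient_of q) = int (p ^ k))"

definition N :: "'a::euclidean_space set \<Rightarrow> 'a set \<Rightarrow> nat \<Rightarrow> nat \<Rightarrow> nat" where
  "N \<Phi> \<Delta> m p =
     card {a \<in> regular_weights \<Phi> \<Delta> m.
             \<forall>w\<in>weight_lattice \<Phi>. denominator_is_power ((w \<bullet> a) / real m) p}"

text \<open>
  Dynkin type \<open>E\<^sub>7\<close>, in Bourbaki's labelling: a chain 1, 3, 4, 5, 6, 7 with node 2
  attached to node 4.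
\<close>

definition E7_edges :: "nat set set" where
  "E7_edges = {{1,3}, {3,4}, {4,5}, {5,6}, {6,7}, {2,4}}"

definition type_E7 :: "'a::euclidean_space set \<Rightarrow> bool" where
  "type_E7 \<Delta> \<longleftrightarrow>
     (\<exists>\<alpha> :: nat \<Rightarrow> 'a. bij_betw \<alpha> {1..7} \<Delta> \<and>
        (\<forall>i\<in>{1..7}. \<forall>j\<in>{1..7}.
           \<alpha> i \<bullet> coroot (\<alpha> j) =
             (if i = j then 2 else if {i, j} \<in> E7_edges then -1 else 0)))"

text \<open>
  The set \<open>(1/\<surd>2) \<int> \<times> (\<int>\<^sup>6 \<union> (\<int> + 1/2)\<^sup>6)\<close>. The type \<open>real\<close> being a field, \<open>dvd\<close> and
  \<open>cong\<close> are degenerate on it, so divisibility and congruence of real numbers modulo 2 are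
  expressed below by \<^const>\<open>rcong\<close>, i.e. the difference is 2 times an integer.
\<close>

definition tuples :: "(real \<times> real \<times> real \<times> real \<times> real \<times> real \<times> real) set" where
  "tuples =
     {(b1, b2, b3, b4, b5, b6, b7).
        (\<exists>k::int. b1 = 1 / sqrt 2 * of_int k) \<and>
        ((\<forall>b\<in>{b2, b3, b4, b5, b6, b7}. b \<in> \<int>) \<or>
         (\<forall>b\<in>{b2, b3, b4, b5, b6, b7}. b - 1/2 \<in> \<int>))}"

end

theory Submission
  imports Defs
begin

text \<open>
  Write \<open>r\<close> for the part of \<open>m\<close> prime to \<open>p\<close>. Inner products of weights lie in \<open>(1/2) \<int>\<close>, the root
  lattice \<open>Q\<close> is dual to the weight lattice \<open>P\<close>, and \<open>2 P \<subseteq> Q\<close>. Hence a weight \<open>a\<close> has all the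
  denominators powers of \<open>p\<close> iff \<open>a / r \<in> Q\<close> for odd \<open>p\<close>, and iff \<open>a / r \<in> P\<close> for \<open>p = 2\<close>
  (where \<open>r\<close> is odd). So \<open>N\<close> counts the points of \<open>Q\<close> or \<open>P\<close> in the interior of the alcove of level
  \<open>p ^ i\<close>, and the tuples are these points in coordinates adapted to the subsystem of type
  \<open>D\<^sub>6 \<times> A\<^sub>1\<close>.
\<close>

declare One_nat_def [simp del] \<comment> \<open>it would rewrite \<open>\<alpha> 1\<close>\<close>

section \<open>Integrality and denominators\<close>

lemma Ints_I: "x = of_int n \<Longrightarrow> x \<in> \<int>"
  by simp

lemma rcong_2_iff: "[a = b] (rmod 2) \<longleftrightarrow> (a - b) / 2 \<in> \<int>"
proof
  assume "[a = b] (rmod 2)"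
  then obtain n where "b = a + of_int n * 2" by (auto simp: rcong_altdef)
  then show "(a - b) / 2 \<in> \<int>" by simp
next
  assume "(a - b) / 2 \<in> \<int>"
  then obtain n where "(a - b) / 2 = of_int n" by (elim Ints_cases)
  then have "b = a + of_int (- n) * 2" by simp
  then show "[a = b] (rmod 2)" unfolding rcong_altdef by blast
qed

text \<open>Reducing to lowest terms only replaces the denominator by a divisor, and every divisor
  of a power of the prime \<open>p\<close> is again a power of \<open>p\<close>. This removes lowest
  terms from the rest of the argument.\<close>

lemma denominator_is_power_iff:
  assumes "prime p"
  shows "denominator_is_power x p \<longleftrightarrow> (\<exists>k. x * real (p ^ k) \<in> \<int>)"
proof
  assume "denominator_is_power x p"
  then obtain q k where q: "x = of_rat q" "snd (quotient_of q) = int (p ^ k)"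
    unfolding denominator_is_power_def by blast
  obtain u where u: "quotient_of q = (u, int (p ^ k))"
    using q(2) by (metis prod.collapse)
  have "x = of_int u / real (p ^ k)"
    using quotient_of_div[OF u] q(1) by (simp add: of_rat_divide of_rat_power)
  then have "x * real (p ^ k) = of_int u"
    using assms by (simp add: prime_gt_0_nat)
  then show "\<exists>k. x * real (p ^ k) \<in> \<int>" by (metis Ints_of_int)
next
  assume "\<exists>k. x * real (p ^ k) \<in> \<int>"
  then obtain k n where n: "x * real (p ^ k) = of_int n" by (auto elim: Ints_cases)
  define q where "q = Fract n (int (p ^ k))"
  have pk: "int (p ^ k) > 0" using assms by (simp add: prime_gt_0_nat)
  then have "(of_rat q :: real) = of_int n / real (p ^ k)"
    by (simp add: q_def of_rat_rat)
  moreover have "real (p ^ k) \<noteq> 0" using assms by (simp add: prime_gt_0_nat)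
  ultimately have x: "x = of_rat q" using n by (metis nonzero_mult_div_cancel_right)
  obtain u v where uv: "quotient_of q = (u, v)" by force
  have v: "v > 0" "coprime u v"
    using uv quotient_of_denom_pos quotient_of_coprime by blast+
  have "q = Fract u v" using uv by (simp add: quotient_of_div Fract_of_int_quotient)
  then have "u * int (p ^ k) = n * v"
    using v pk by (simp add: q_def eq_rat)
  \<comment> \<open>Coprimality of \<open>u\<close> and \<open>v\<close> now puts the whole of
    \<open>v\<close> into the factor \<open>p ^ k\<close>.\<close>
  then have "v dvd u * int (p ^ k)" by simp
  then have "v dvd int (p ^ k)"
    using v(2) by (simp add: coprime_dvd_mult_right_iff coprime_commute)
  then have "nat v dvd p ^ k" using v(1) by (simp add: nat_dvd_iff)
  then obtain j where "nat v = p ^ j"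
    using assms divides_primepow_nat by blast
  then have "snd (quotient_of q) = int (p ^ j)" using uv v(1) by (metis int_nat_eq less_imp_le snd_conv)
  then show "denominator_is_power x p"
    unfolding denominator_is_power_def using x by blast
qed

text \<open>Powers of \<open>p\<close> in the denominator are free, so \<open>i\<close> drops out;
  \<open>r\<close> is coprime to \<open>p\<close> and must therefore divide \<open>s\<close>
  itself.\<close>

lemma denominator_is_power_divide_iff:
  assumes p: "prime p" "\<not> p dvd r" and s: "s \<in> \<int>"
  shows "denominator_is_power (s / real (p ^ i * r)) p \<longleftrightarrow> s / real r \<in> \<int>"
proof -
  obtain n where n: "s = of_int n" using s by (elim Ints_cases)
  have r: "real r \<noteq> 0" using p(2) by (metis dvd_0_right of_nat_eq_0_iff)
  have p0: "real p \<noteq> 0" using p(1) by auto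
  show ?thesis
  proof
    assume "denominator_is_power (s / real (p ^ i * r)) p"
    then obtain k l where "s / real (p ^ i * r) * real (p ^ k) = of_int l"
      unfolding denominator_is_power_iff[OF p(1)] by (auto elim: Ints_cases)
    then have "real_of_int (n * int p ^ k) = real_of_int (l * int p ^ i * int r)"
      using r p0 by (simp add: n field_simps)
    then have "int r dvd n * int p ^ k"
      unfolding of_int_eq_iff by simp
    moreover have "coprime (int r) (int p ^ k)"
      using p by (simp add: coprime_commute prime_imp_coprime)
    ultimately have "int r dvd n"
      by (simp add: coprime_dvd_mult_left_iff)
    then obtain c where "n = int r * c" ..
    then show "s / real r \<in> \<int>" using r by (simp add: n)
  next
    assume "s / real r \<in> \<int>"
    moreover have "s / real (p ^ i * r) * real (p ^ i) = s / real r"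
      using p0 by simp
    ultimately show "denominator_is_power (s / real (p ^ i * r)) p"
      unfolding denominator_is_power_iff[OF p(1)] by metis
  qed
qed

text \<open>The left side lists the pairings of \<open>V k b2 ... b7\<close> with \<alpha> 1, ...,
  \<alpha> 7. Integral differences put all \<open>b\<close> in one class modulo the integers, and
  \<open>b6 + b7\<close> makes this class 0 or 1/2. Then \<open>b2 + ... + b6 - b7\<close> is an
  integer, so its sign in the parity condition may be changed.\<close>

lemma weight_coordinates_iff:
  fixes k b2 b3 b4 b5 b6 b7 :: real
  shows "((k - (b2 + b3 + b4 + b5 + b6 - b7)) / 2 \<in> \<int> \<and> b6 + b7 \<in> \<int> \<and> b6 - b7 \<in> \<int> \<and>
      b5 - b6 \<in> \<int> \<and> b4 - b5 \<in> \<int> \<and> b3 - b4 \<in> \<int> \<and> b2 - b3 \<in> \<int>) \<longleftrightarrow>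
    k \<in> \<int> \<and> ((\<forall>b\<in>{b2, b3, b4, b5, b6, b7}. b \<in> \<int>) \<or> (\<forall>b\<in>{b2, b3, b4, b5, b6, b7}. b - 1/2 \<in> \<int>)) \<and>
    (k + b2 + b3 + b4 + b5 + b6 - b7) / 2 \<in> \<int>" (is "?L \<longleftrightarrow> ?R")
proof
  assume ?L
  then obtain x1 x2 x3 x4 x5 x6 x7 where
    x: "(k - (b2 + b3 + b4 + b5 + b6 - b7)) / 2 = of_int x1" "b6 + b7 = of_int x2"
      "b6 - b7 = of_int x3" "b5 - b6 = of_int x4" "b4 - b5 = of_int x5" "b3 - b4 = of_int x6"
      "b2 - b3 = of_int x7"
    by (elim conjE Ints_cases) blast
  \<comment> \<open>Since \<open>x2 + x3 = 2 * b6\<close>, the common class of the coordinates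
    modulo the integers is \<open>c / 2\<close>.\<close>
  define c where "c = (x2 + x3) mod 2"
  define B where "B = (x2 + x3) div 2"
  have "x2 + x3 = 2 * B + c" by (simp add: B_def c_def)
  then have "real_of_int x2 + of_int x3 = 2 * of_int B + of_int c"
    by (metis of_int_add of_int_mult of_int_numeral)
  then have b: "b6 - of_int c / 2 = of_int B" "b5 - of_int c / 2 = of_int (B + x4)"
      "b4 - of_int c / 2 = of_int (B + x4 + x5)" "b3 - of_int c / 2 = of_int (B + x4 + x5 + x6)"
      "b2 - of_int c / 2 = of_int (B + x4 + x5 + x6 + x7)" "b7 - of_int c / 2 = of_int (B - x3)"
    using x by simp_all
  then have "\<forall>b\<in>{b2, b3, b4, b5, b6, b7}. b - of_int c / 2 \<in> \<int>"
    by (metis Ints_of_int insert_iff empty_iff)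
  moreover have "c = 0 \<or> c = 1" unfolding c_def by presburger
  ultimately have halves: "(\<forall>b\<in>{b2, b3, b4, b5, b6, b7}. b \<in> \<int>) \<or>
      (\<forall>b\<in>{b2, b3, b4, b5, b6, b7}. b - 1/2 \<in> \<int>)" by auto
  define S where "S = 4 * B + 4 * x4 + 3 * x5 + 2 * x6 + x7 + x3 + 2 * c"
  have S: "b2 + b3 + b4 + b5 + b6 - b7 = of_int S"
    using b by (simp add: S_def)
  have "k = of_int (2 * x1 + S)" "(k + b2 + b3 + b4 + b5 + b6 - b7) / 2 = of_int (x1 + S)"
    using x(1) S by simp_all
  then show ?R using halves by (metis Ints_of_int)
next
  assume R: ?R
  then obtain c where c: "c = 0 \<or> c = 1/2" and "\<forall>b\<in>{b2, b3, b4, b5, b6, b7}. b - c \<in> \<int>"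
    by (metis diff_zero)
  then have b: "b2 - c \<in> \<int>" "b3 - c \<in> \<int>" "b4 - c \<in> \<int>" "b5 - c \<in> \<int>" "b6 - c \<in> \<int>" "b7 - c \<in> \<int>"
    by simp_all
  \<comment> \<open>\<open>2 * c\<close> is the shift in \<open>b6 + b7\<close>, and
    \<open>4 * c\<close> the shift in the sum with five plus signs and one minus sign.\<close>
  have "2 * c = 0 \<or> 2 * c = 1" "4 * c = 0 \<or> 4 * c = 2" using c by auto
  then have c2: "2 * c \<in> \<int>" "4 * c \<in> \<int>" by (metis Ints_0 Ints_1 Ints_numeral)+
  have "b5 - b6 = (b5 - c) - (b6 - c)" "b4 - b5 = (b4 - c) - (b5 - c)"
    "b3 - b4 = (b3 - c) - (b4 - c)" "b2 - b3 = (b2 - c) - (b3 - c)"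
    "b6 - b7 = (b6 - c) - (b7 - c)" "b6 + b7 = (b6 - c) + (b7 - c) + 2 * c"
    "(k - (b2 + b3 + b4 + b5 + b6 - b7)) / 2 = (k + b2 + b3 + b4 + b5 + b6 - b7) / 2 -
      ((b2 - c) + (b3 - c) + (b4 - c) + (b5 - c) + (b6 - c) - (b7 - c) + 4 * c)"
    by (simp_all add: field_simps)
  then show ?L
    using R b c2 by (simp only: Ints_add Ints_diff)
qed

text \<open>The left side lists the coefficients of \<open>V k b2 ... b7\<close> in the simple
  roots. Differences of these coefficients give \<open>b - k / 2\<close> up to integer multiples of
  \<open>k\<close>, so every \<open>b\<close> has the class of \<open>k / 2\<close> modulo the
  integers; the coefficient at \<alpha> 2 gives the last parity condition.\<close>

lemma root_coordinates_iff:
  fixes k b2 b3 b4 b5 b6 b7 :: real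
  shows "(k \<in> \<int> \<and> k + (b2 + b3 + b4 + b5 + b6 + b7) / 2 \<in> \<int> \<and>
      3 * k / 2 + (b2 + b3 + b4 + b5 + b6 - b7) / 2 \<in> \<int> \<and> 2 * k + b2 + b3 + b4 + b5 \<in> \<int> \<and>
      3 * k / 2 + b2 + b3 + b4 \<in> \<int> \<and> k + b2 + b3 \<in> \<int> \<and> k / 2 + b2 \<in> \<int>) \<longleftrightarrow>
    k \<in> \<int> \<and> ((\<forall>b\<in>{b2, b3, b4, b5, b6, b7}. b \<in> \<int>) \<or> (\<forall>b\<in>{b2, b3, b4, b5, b6, b7}. b - 1/2 \<in> \<int>)) \<and>
    (\<forall>b\<in>{b2, b3, b4, b5, b6, b7}. (2 * b - k) / 2 \<in> \<int>) \<and>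
    (b2 + b3 + b4 + b5 + b6 + b7) / 2 \<in> \<int>" (is "?L \<longleftrightarrow> ?R")
proof
  assume ?L
  then obtain y1 y2 y3 y4 y5 y6 y7 where
    y: "k = of_int y1" "k + (b2 + b3 + b4 + b5 + b6 + b7) / 2 = of_int y2"
      "3 * k / 2 + (b2 + b3 + b4 + b5 + b6 - b7) / 2 = of_int y3"
      "2 * k + b2 + b3 + b4 + b5 = of_int y4" "3 * k / 2 + b2 + b3 + b4 = of_int y5"
      "k + b2 + b3 = of_int y6" "k / 2 + b2 = of_int y7"
    by (elim conjE Ints_cases) blast
  have b: "(2 * b2 - k) / 2 = of_int (y7 - y1)" "(2 * b3 - k) / 2 = of_int (y6 - y7 - y1)"
    "(2 * b4 - k) / 2 = of_int (y5 - y6 - y1)" "(2 * b5 - k) / 2 = of_int (y4 - y5 - y1)"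
    "(2 * b6 - k) / 2 = of_int (y2 + y3 - y4 - y1)" "(2 * b7 - k) / 2 = of_int (y2 - y3)"
    "(b2 + b3 + b4 + b5 + b6 + b7) / 2 = of_int (y2 - y1)"
    unfolding of_int_add of_int_diff y[symmetric] by (simp_all add: field_simps)
  then have cong: "\<forall>b\<in>{b2, b3, b4, b5, b6, b7}. (2 * b - k) / 2 \<in> \<int>"
    by (metis Ints_of_int insert_iff empty_iff)
  define c where "c = y1 mod 2"
  have "y1 = 2 * (y1 div 2) + c" by (simp add: c_def)
  then have "k = 2 * of_int (y1 div 2) + of_int c"
    using y(1) by (metis of_int_add of_int_mult of_int_numeral)
  then have "b - of_int c / 2 = (2 * b - k) / 2 + of_int (y1 div 2)" for b
    by (simp add: field_simps)
  then have "\<forall>b\<in>{b2, b3, b4, b5, b6, b7}. b - of_int c / 2 \<in> \<int>"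
    using cong by (metis Ints_add Ints_of_int)
  moreover have "c = 0 \<or> c = 1" unfolding c_def by presburger
  ultimately have "(\<forall>b\<in>{b2, b3, b4, b5, b6, b7}. b \<in> \<int>) \<or>
      (\<forall>b\<in>{b2, b3, b4, b5, b6, b7}. b - 1/2 \<in> \<int>)" by auto
  then show ?R using y(1) b(7) cong by (metis Ints_of_int)
next
  assume R: ?R
  then have k: "k \<in> \<int>" "2 * k \<in> \<int>" "3 * k \<in> \<int>" "4 * k \<in> \<int>"
    by (simp_all add: Ints_mult)
  have b: "(2 * b2 - k) / 2 \<in> \<int>" "(2 * b3 - k) / 2 \<in> \<int>" "(2 * b4 - k) / 2 \<in> \<int>"
    "(2 * b5 - k) / 2 \<in> \<int>" "(2 * b6 - k) / 2 \<in> \<int>" "(2 * b7 - k) / 2 \<in> \<int>"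
    using R by simp_all
  have "3 * k / 2 + (b2 + b3 + b4 + b5 + b6 - b7) / 2 =
      (b2 + b3 + b4 + b5 + b6 + b7) / 2 - (2 * b7 - k) / 2 + k"
    "2 * k + b2 + b3 + b4 + b5 =
      (2 * b2 - k) / 2 + (2 * b3 - k) / 2 + (2 * b4 - k) / 2 + (2 * b5 - k) / 2 + 4 * k"
    "3 * k / 2 + b2 + b3 + b4 = (2 * b2 - k) / 2 + (2 * b3 - k) / 2 + (2 * b4 - k) / 2 + 3 * k"
    "k + b2 + b3 = (2 * b2 - k) / 2 + (2 * b3 - k) / 2 + 2 * k"
    "k / 2 + b2 = (2 * b2 - k) / 2 + k"
    by (simp_all add: field_simps)
  then show ?L
    using R b k by (simp only: Ints_add Ints_diff)
qed

text \<open>If the coordinates are half-odd, six squares of size at least 1/4 already reach 3/2. If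
  they are integers, the bound leaves only \<open>K\<close> in {-1, 0, 1} with a sum of squares
  \<open>s\<close> at most 1, and the parity of \<open>K + s\<close> excludes everything but
  zero.\<close>

lemma E7_weight_norm_ge:
  fixes k b2 b3 b4 b5 b6 b7 :: real
  assumes int: "(k - (b2 + b3 + b4 + b5 + b6 - b7)) / 2 \<in> \<int>" "b6 + b7 \<in> \<int>" "b6 - b7 \<in> \<int>"
      "b5 - b6 \<in> \<int>" "b4 - b5 \<in> \<int>" "b3 - b4 \<in> \<int>" "b2 - b3 \<in> \<int>"
    and less: "k * k / 2 + b2 * b2 + b3 * b3 + b4 * b4 + b5 * b5 + b6 * b6 + b7 * b7 < 3 / 2"
  shows "k = 0 \<and> b2 = 0 \<and> b3 = 0 \<and> b4 = 0 \<and> b5 = 0 \<and> b6 = 0 \<and> b7 = 0"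
proof -
  obtain x1 x2 x3 x4 x5 x6 x7 where
    x: "(k - (b2 + b3 + b4 + b5 + b6 - b7)) / 2 = of_int x1" "b6 + b7 = of_int x2"
      "b6 - b7 = of_int x3" "b5 - b6 = of_int x4" "b4 - b5 = of_int x5" "b3 - b4 = of_int x6"
      "b2 - b3 = of_int x7"
    using int by (elim Ints_cases) blast
  show ?thesis
  proof (cases "even (x2 + x3)")
    case False
    have odd_square: "1 / 4 \<le> b * b" if "2 * b = of_int c" "odd c" for b :: real and c :: int
    proof -
      have "\<bar>c\<bar> \<ge> 1" using that(2) by presburger
      then have "1 \<le> \<bar>2 * b\<bar>" using that(1) by simp
      then have "1 * 1 \<le> \<bar>2 * b\<bar> * \<bar>2 * b\<bar>" by (intro mult_mono) auto
      then show ?thesis by (simp add: abs_mult_self_eq)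
    qed
    have "1/4 \<le> b7 * b7" using x False by (intro odd_square[of _ "x2 - x3"]) auto
    moreover have "1/4 \<le> b6 * b6" using x False by (intro odd_square[of _ "x2 + x3"]) auto
    moreover have "1/4 \<le> b5 * b5" using x False by (intro odd_square[of _ "x2 + x3 + 2 * x4"]) auto
    moreover have "1/4 \<le> b4 * b4"
      using x False by (intro odd_square[of _ "x2 + x3 + 2 * x4 + 2 * x5"]) auto
    moreover have "1/4 \<le> b3 * b3"
      using x False by (intro odd_square[of _ "x2 + x3 + 2 * x4 + 2 * x5 + 2 * x6"]) auto
    moreover have "1/4 \<le> b2 * b2"
      using x False by (intro odd_square[of _ "x2 + x3 + 2 * x4 + 2 * x5 + 2 * x6 + 2 * x7"]) auto
    ultimately have False using less zero_le_square[of k] by linarith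
    then show ?thesis ..
  next
    case True
    then obtain B6 where B6: "x2 + x3 = 2 * B6" by blast
    define B2 B3 B4 B5 B7 where
      "B2 = B6 + x4 + x5 + x6 + x7" "B3 = B6 + x4 + x5 + x6" "B4 = B6 + x4 + x5" "B5 = B6 + x4"
      "B7 = x2 - B6"
    note B_defs = this
    define K where "K = 2 * x1 + (B2 + B3 + B4 + B5 + B6 - B7)"
    have "real_of_int x2 + of_int x3 = 2 * of_int B6"
      using B6 by (metis of_int_add of_int_mult of_int_numeral)
    then have b: "b2 = of_int B2" "b3 = of_int B3" "b4 = of_int B4" "b5 = of_int B5"
        "b6 = of_int B6" "b7 = of_int B7"
      using x by (simp_all add: B_defs)
    have k: "k = of_int K"
      using x(1) by (simp add: b K_def)
    define s where "s = B2 * B2 + B3 * B3 + B4 * B4 + B5 * B5 + B6 * B6 + B7 * B7"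
    have "real_of_int (K * K + 2 * s) < of_int 3"
      using less by (simp add: b k s_def)
    then have le: "K * K + 2 * s < 3" by (simp only: of_int_less_iff)
    have s_nonneg: "s \<ge> 0" by (simp add: s_def)
    \<comment> \<open>\<open>K\<close> is congruent modulo 2 to the sum of the \<open>B\<close>, and
      each \<open>B\<close> is congruent to its square.\<close>
    have parity: "even (K + s)" by (auto simp: K_def s_def)
    have "\<bar>K\<bar> < 2"
    proof (rule ccontr)
      assume "\<not> \<bar>K\<bar> < 2"
      then have "2 * 2 \<le> \<bar>K\<bar> * \<bar>K\<bar>" by (intro mult_mono) auto
      then show False using le s_nonneg by simp
    qed
    then have "K = 0 \<or> K = 1 \<or> K = -1" by linarith
    then have "K = 0 \<and> s = 0"
      using le s_nonneg parity by (elim disjE) (simp_all, presburger+)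
    moreover from this have "B2 = 0 \<and> B3 = 0 \<and> B4 = 0 \<and> B5 = 0 \<and> B6 = 0 \<and> B7 = 0"
      unfolding s_def by (simp add: add_nonneg_eq_0_iff)
    ultimately show ?thesis by (simp add: b k)
  qed
qed

section \<open>Coordinates for a root system of type \<open>E\<^sub>7\<close>\<close>

locale E7_datum =
  fixes \<Phi> \<Delta> :: "'a::euclidean_space set" and \<alpha> :: "nat \<Rightarrow> 'a"
  assumes datum: "simple_root_datum \<Phi> \<Delta>"
    and bij_simple: "bij_betw \<alpha> {1..7} \<Delta>"
    and cartan: "\<And>i j. i \<in> {1..7} \<Longrightarrow> j \<in> {1..7} \<Longrightarrow>
      \<alpha> i \<bullet> coroot (\<alpha> j) = (if i = j then 2 else if {i, j} \<in> E7_edges then -1 else 0)"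
begin

lemma finite_roots: "finite \<Phi>" and zero_not_root: "0 \<notin> \<Phi>" and span_roots: "span \<Phi> = UNIV"
  and reflection_root: "\<beta> \<in> \<Phi> \<Longrightarrow> \<gamma> \<in> \<Phi> \<Longrightarrow> root_reflection \<beta> \<gamma> \<in> \<Phi>"
  and coroot_integral: "\<beta> \<in> \<Phi> \<Longrightarrow> \<gamma> \<in> \<Phi> \<Longrightarrow> \<gamma> \<bullet> coroot \<beta> \<in> \<int>"
  and roots_nonempty: "\<Phi> \<noteq> {}"
  and simple_subset: "\<Delta> \<subseteq> \<Phi>"
  and root_sign: "\<beta> \<in> \<Phi> \<Longrightarrow> \<beta> \<in> nonneg_combinations \<Delta> \<or> - \<beta> \<in> nonneg_combinations \<Delta>"
  and long_norm: "long_root \<Phi> \<beta> \<Longrightarrow> \<beta> \<bullet> \<beta> = 2"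
  using datum
  unfolding simple_root_datum_def root_system_def irreducible_roots_def base_of_def by auto

lemma interval_7: "{1..7} = {1, 2, 3, 4, 5, 6, 7::nat}"
  by auto

lemma simple_eq: "\<Delta> = {\<alpha> 1, \<alpha> 2, \<alpha> 3, \<alpha> 4, \<alpha> 5, \<alpha> 6, \<alpha> 7}"
  using bij_betw_imp_surj_on[OF bij_simple] unfolding interval_7 by auto

lemma simple_root: "i \<in> {1..7} \<Longrightarrow> \<alpha> i \<in> \<Phi>"
  using simple_subset bij_betw_apply[OF bij_simple] by blast

lemma simple_nonzero: "i \<in> {1..7} \<Longrightarrow> \<alpha> i \<noteq> 0"
  using simple_root zero_not_root by metis

text \<open>The normalisation speaks of long roots only, and the simple roots are not yet known to
  be long. Their norm is carried as an unknown scale until \<open>half_norm_eq_1\<close>.\<close>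

definition half_norm :: real where "half_norm = \<alpha> 4 \<bullet> \<alpha> 4 / 2"

lemma half_norm_pos: "half_norm > 0"
  using simple_nonzero[of 4] by (simp add: half_norm_def)

lemma inner_cartan:
  assumes "i \<in> {1..7}" "j \<in> {1..7}"
  shows "\<alpha> i \<bullet> \<alpha> j =
    (if i = j then 2 else if {i, j} \<in> E7_edges then -1 else 0) * (\<alpha> j \<bullet> \<alpha> j / 2)"
  using cartan[OF assms] simple_nonzero[OF assms(2)]
  by (simp add: coroot_def field_simps split: if_splits)

text \<open>Both Cartan integers along an edge are -1, which forces equal lengths. As the diagram is
  connected, all simple roots then have the norm of \<alpha> 4.\<close>

lemma edge_norms:
  assumes "i \<in> {1..7}" "j \<in> {1..7}" "i \<noteq> j" "{i, j} \<in> E7_edges"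
  shows "\<alpha> i \<bullet> \<alpha> i = \<alpha> j \<bullet> \<alpha> j"
  using inner_cartan[of i j] inner_cartan[of j i] assms
  by (simp add: inner_commute insert_commute)

lemma simple_norms: "i \<in> {1..7} \<Longrightarrow> \<alpha> i \<bullet> \<alpha> i = 2 * half_norm"
  using edge_norms[of 1 3] edge_norms[of 3 4] edge_norms[of 4 5] edge_norms[of 5 6]
    edge_norms[of 6 7] edge_norms[of 2 4]
  unfolding interval_7 by (auto simp: half_norm_def E7_edges_def)

lemma gram:
  assumes "i \<in> {1..7}" "j \<in> {1..7}"
  shows "\<alpha> i \<bullet> \<alpha> j =
    (if i = j then 2 else if {i, j} \<in> E7_edges then -1 else 0) * half_norm"
  using inner_cartan[OF assms] simple_norms[OF assms(2)] by simp

text \<open>Nodes 2 to 7 form a diagram of type D6. The vectors solve the standard equations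
  \<alpha> 7 = e2 - e3, \<alpha> 6 = e3 - e4, \<alpha> 5 = e4 - e5, \<alpha> 4 = e5 - e6, \<alpha> 3
  = e6 - e7, \<alpha> 2 = e6 + e7.\<close>

definition e2 where "e2 = \<alpha> 7 + \<alpha> 6 + \<alpha> 5 + \<alpha> 4 + (1/2) *\<^sub>R (\<alpha> 2 + \<alpha> 3)"
definition e3 where "e3 = \<alpha> 6 + \<alpha> 5 + \<alpha> 4 + (1/2) *\<^sub>R (\<alpha> 2 + \<alpha> 3)"
definition e4 where "e4 = \<alpha> 5 + \<alpha> 4 + (1/2) *\<^sub>R (\<alpha> 2 + \<alpha> 3)"
definition e5 where "e5 = \<alpha> 4 + (1/2) *\<^sub>R (\<alpha> 2 + \<alpha> 3)"
definition e6 where "e6 = (1/2) *\<^sub>R (\<alpha> 2 + \<alpha> 3)"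
definition e7 where "e7 = (1/2) *\<^sub>R (\<alpha> 2 - \<alpha> 3)"
text \<open>This is the component of \<alpha> 1 orthogonal to the D6 part.\<close>

definition h where "h = \<alpha> 1 + (1/2) *\<^sub>R (e2 + e3 + e4 + e5 + e6 - e7)"

lemmas frame_defs = e2_def e3_def e4_def e5_def e6_def e7_def

lemma gram_e:
  "e2 \<bullet> e2 = half_norm" "e3 \<bullet> e3 = half_norm" "e4 \<bullet> e4 = half_norm"
  "e5 \<bullet> e5 = half_norm" "e6 \<bullet> e6 = half_norm" "e7 \<bullet> e7 = half_norm"
  "e2 \<bullet> e3 = 0" "e2 \<bullet> e4 = 0" "e2 \<bullet> e5 = 0" "e2 \<bullet> e6 = 0" "e2 \<bullet> e7 = 0"
  "e3 \<bullet> e4 = 0" "e3 \<bullet> e5 = 0" "e3 \<bullet> e6 = 0" "e3 \<bullet> e7 = 0"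
  "e4 \<bullet> e5 = 0" "e4 \<bullet> e6 = 0" "e4 \<bullet> e7 = 0"
  "e5 \<bullet> e6 = 0" "e5 \<bullet> e7 = 0" "e6 \<bullet> e7 = 0"
  by (simp_all add: frame_defs inner_simps gram E7_edges_def doubleton_eq_iff)

lemma inner_h_e:
  "h \<bullet> e2 = 0" "h \<bullet> e3 = 0" "h \<bullet> e4 = 0" "h \<bullet> e5 = 0" "h \<bullet> e6 = 0" "h \<bullet> e7 = 0"
  by (simp_all add: h_def frame_defs inner_simps gram E7_edges_def doubleton_eq_iff)

lemma inner_h_h: "h \<bullet> h = half_norm / 2"
  by (simp add: h_def frame_defs inner_simps gram E7_edges_def doubleton_eq_iff)

text \<open>
  The vectors \<open>e2, \<dots>, e7, h\<close> are orthogonal, with \<open>h\<close> half the highest root. The coordinates of the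
  statement are \<open>b\<^sub>1 = k / \<surd>2\<close> and \<open>b\<^sub>2, \<dots>, b\<^sub>7\<close>; the rescaled \<open>k\<close> avoids irrational coefficients.
\<close>

definition V :: "real \<Rightarrow> real \<Rightarrow> real \<Rightarrow> real \<Rightarrow> real \<Rightarrow> real \<Rightarrow> real \<Rightarrow> 'a" where
  "V k b2 b3 b4 b5 b6 b7 = k *\<^sub>R h + b2 *\<^sub>R e2 + b3 *\<^sub>R e3 + b4 *\<^sub>R e4
     + b5 *\<^sub>R e5 + b6 *\<^sub>R e6 + b7 *\<^sub>R e7"

lemma inner_V:
  "V k b2 b3 b4 b5 b6 b7 \<bullet> V k' c2 c3 c4 c5 c6 c7 =
     half_norm * (k * k' / 2 + b2 * c2 + b3 * c3 + b4 * c4 + b5 * c5 + b6 * c6 + b7 * c7)"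
proof -
  have "e3 \<bullet> e2 = 0" "e4 \<bullet> e2 = 0" "e5 \<bullet> e2 = 0" "e6 \<bullet> e2 = 0" "e7 \<bullet> e2 = 0"
    "e4 \<bullet> e3 = 0" "e5 \<bullet> e3 = 0" "e6 \<bullet> e3 = 0" "e7 \<bullet> e3 = 0"
    "e5 \<bullet> e4 = 0" "e6 \<bullet> e4 = 0" "e7 \<bullet> e4 = 0"
    "e6 \<bullet> e5 = 0" "e7 \<bullet> e5 = 0" "e7 \<bullet> e6 = 0"
    "e2 \<bullet> h = 0" "e3 \<bullet> h = 0" "e4 \<bullet> h = 0" "e5 \<bullet> h = 0" "e6 \<bullet> h = 0" "e7 \<bullet> h = 0"
    using gram_e inner_h_e by (simp_all add: inner_commute)
  then show ?thesis
    unfolding V_def by (simp add: inner_add_left inner_add_right gram_e inner_h_e inner_h_h) (simp add: algebra_simps)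
qed

lemma V_add: "V k b2 b3 b4 b5 b6 b7 + V k' c2 c3 c4 c5 c6 c7 =
    V (k + k') (b2 + c2) (b3 + c3) (b4 + c4) (b5 + c5) (b6 + c6) (b7 + c7)"
  and V_diff: "V k b2 b3 b4 b5 b6 b7 - V k' c2 c3 c4 c5 c6 c7 =
    V (k - k') (b2 - c2) (b3 - c3) (b4 - c4) (b5 - c5) (b6 - c6) (b7 - c7)"
  and V_scaleR: "r *\<^sub>R V k b2 b3 b4 b5 b6 b7 =
    V (r * k) (r * b2) (r * b3) (r * b4) (r * b5) (r * b6) (r * b7)"
  by (simp_all add: V_def algebra_simps)

lemma simple_V:
  "\<alpha> 1 = V 1 (-1/2) (-1/2) (-1/2) (-1/2) (-1/2) (1/2)"
  "\<alpha> 2 = V 0 0 0 0 0 1 1"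
  "\<alpha> 3 = V 0 0 0 0 0 1 (-1)"
  "\<alpha> 4 = V 0 0 0 0 1 (-1) 0"
  "\<alpha> 5 = V 0 0 0 1 (-1) 0 0"
  "\<alpha> 6 = V 0 0 1 (-1) 0 0 0"
  "\<alpha> 7 = V 0 1 (-1) 0 0 0 0"
proof -
  have half: "(1/2) *\<^sub>R x + (1/2) *\<^sub>R x = x" for x :: 'a
    by (simp flip: scaleR_add_left)
  show "\<alpha> 1 = V 1 (-1/2) (-1/2) (-1/2) (-1/2) (-1/2) (1/2)"
    by (simp add: V_def h_def algebra_simps)
  show "\<alpha> 2 = V 0 0 0 0 0 1 1" "\<alpha> 3 = V 0 0 0 0 0 1 (-1)"
    using half[of "\<alpha> 2"] half[of "\<alpha> 3"]
    by (simp_all add: V_def frame_defs algebra_simps)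
qed (simp_all add: V_def frame_defs algebra_simps)

text \<open>The roots span the space and are combinations of the simple roots, all of which have the
  form \<open>V\<close>.\<close>

lemma V_exists:
  obtains k b2 b3 b4 b5 b6 b7 where "x = V k b2 b3 b4 b5 b6 b7"
proof -
  have "\<Phi> \<subseteq> span \<Delta>"
  proof
    fix \<beta> assume "\<beta> \<in> \<Phi>"
    have *: "y \<in> span \<Delta>" if "y \<in> nonneg_combinations \<Delta>" for y
      using that unfolding nonneg_combinations_def by (auto intro: span_sum span_scale span_base)
    show "\<beta> \<in> span \<Delta>"
      using root_sign[OF \<open>\<beta> \<in> \<Phi>\<close>] *[of \<beta>] *[of "-\<beta>"] span_neg[of "-\<beta>" \<Delta>] by auto
  qed
  then have "span \<Delta> = UNIV"
    using span_minimal[OF _ subspace_span] span_roots by blast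
  then have "x \<in> span \<Delta>" by simp
  also have "span \<Delta> \<subseteq> {y. \<exists>k b2 b3 b4 b5 b6 b7. y = V k b2 b3 b4 b5 b6 b7}" (is "_ \<subseteq> ?W")
  proof (rule span_minimal)
    show "\<Delta> \<subseteq> ?W" unfolding simple_eq using simple_V by blast
    have "0 = V 0 0 0 0 0 0 0" by (simp add: V_def)
    then have "0 \<in> ?W" by blast
    moreover have "x + y \<in> ?W" if "x \<in> ?W" "y \<in> ?W" for x y
      using that by clarify (subst V_add, blast)
    moreover have "r *\<^sub>R x \<in> ?W" if "x \<in> ?W" for r x
      using that by clarify (subst V_scaleR, blast)
    ultimately show "subspace ?W"
      unfolding subspace_def by blast
  qed
  finally show ?thesis using that by blast
qed

lemma V_eq_0_iff:
  "V k b2 b3 b4 b5 b6 b7 = 0 \<longleftrightarrow>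
     k = 0 \<and> b2 = 0 \<and> b3 = 0 \<and> b4 = 0 \<and> b5 = 0 \<and> b6 = 0 \<and> b7 = 0"
proof
  assume "V k b2 b3 b4 b5 b6 b7 = 0"
  then have "V k b2 b3 b4 b5 b6 b7 \<bullet> V k b2 b3 b4 b5 b6 b7 = 0" by simp
  then have "k * k / 2 + b2 * b2 + b3 * b3 + b4 * b4 + b5 * b5 + b6 * b6 + b7 * b7 = 0"
    unfolding inner_V using half_norm_pos by simp
  then show "k = 0 \<and> b2 = 0 \<and> b3 = 0 \<and> b4 = 0 \<and> b5 = 0 \<and> b6 = 0 \<and> b7 = 0"
    by (simp add: add_nonneg_eq_0_iff)
qed (simp add: V_def)

lemma V_eq_iff:
  "V k b2 b3 b4 b5 b6 b7 = V k' c2 c3 c4 c5 c6 c7 \<longleftrightarrow>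
     k = k' \<and> b2 = c2 \<and> b3 = c3 \<and> b4 = c4 \<and> b5 = c5 \<and> b6 = c6 \<and> b7 = c7"
  using V_eq_0_iff[of "k - k'" "b2 - c2" "b3 - c3" "b4 - c4" "b5 - c5" "b6 - c6" "b7 - c7"]
  by (simp flip: V_diff)

section \<open>Coefficients with respect to the simple roots\<close>

lemma sum_simple_V:
  "(\<Sum>i\<in>{1..7}. n i *\<^sub>R \<alpha> i) =
     V (n 1) (n 7 - n 1 / 2) (n 6 - n 7 - n 1 / 2) (n 5 - n 6 - n 1 / 2) (n 4 - n 5 - n 1 / 2)
       (n 2 + n 3 - n 4 - n 1 / 2) (n 2 - n 3 + n 1 / 2)"
  unfolding interval_7 by (simp add: simple_V V_scaleR V_add V_eq_iff)

lemma nonneg_combinations_iff: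
  "y \<in> nonneg_combinations \<Delta> \<longleftrightarrow> (\<exists>n :: nat \<Rightarrow> nat. y = (\<Sum>i\<in>{1..7}. real (n i) *\<^sub>R \<alpha> i))"
proof
  assume "y \<in> nonneg_combinations \<Delta>"
  then obtain c where "y = (\<Sum>\<alpha>\<in>\<Delta>. real (c \<alpha>) *\<^sub>R \<alpha>)"
    unfolding nonneg_combinations_def by blast
  then have "y = (\<Sum>i\<in>{1..7}. real (c (\<alpha> i)) *\<^sub>R \<alpha> i)"
    using sum.reindex_bij_betw[OF bij_simple, of "\<lambda>a. real (c a) *\<^sub>R a"] by simp
  then show "\<exists>n :: nat \<Rightarrow> nat. y = (\<Sum>i\<in>{1..7}. real (n i) *\<^sub>R \<alpha> i)"
    by (intro exI[of _ "\<lambda>i. c (\<alpha> i)"])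
next
  assume "\<exists>n :: nat \<Rightarrow> nat. y = (\<Sum>i\<in>{1..7}. real (n i) *\<^sub>R \<alpha> i)"
  then obtain n :: "nat \<Rightarrow> nat" where n: "y = (\<Sum>i\<in>{1..7}. real (n i) *\<^sub>R \<alpha> i)" ..
  define c where "c a = n (the_inv_into {1..7} \<alpha> a)" for a
  have "c (\<alpha> i) = n i" if "i \<in> {1..7}" for i
    using that bij_simple by (simp add: c_def the_inv_into_f_f bij_betw_def)
  then have "y = (\<Sum>i\<in>{1..7}. real (c (\<alpha> i)) *\<^sub>R \<alpha> i)"
    unfolding n by (intro sum.cong) auto
  then have "y = (\<Sum>\<alpha>\<in>\<Delta>. real (c \<alpha>) *\<^sub>R \<alpha>)"
    using sum.reindex_bij_betw[OF bij_simple, of "\<lambda>a. real (c a) *\<^sub>R a"] by simp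
  then show "y \<in> nonneg_combinations \<Delta>"
    unfolding nonneg_combinations_def by blast
qed

lemma root_integer_combination:
  assumes "\<beta> \<in> \<Phi>"
  obtains n :: "nat \<Rightarrow> int" where "\<beta> = (\<Sum>i\<in>{1..7}. of_int (n i) *\<^sub>R \<alpha> i)"
proof (cases "\<beta> \<in> nonneg_combinations \<Delta>")
  case True
  then obtain n :: "nat \<Rightarrow> nat" where "\<beta> = (\<Sum>i\<in>{1..7}. real (n i) *\<^sub>R \<alpha> i)"
    unfolding nonneg_combinations_iff ..
  then show ?thesis by (intro that[of "\<lambda>i. int (n i)"]) simp
next
  case False
  then have "- \<beta> \<in> nonneg_combinations \<Delta>" using root_sign[OF assms] by blast
  then obtain n :: "nat \<Rightarrow> nat" where "- \<beta> = (\<Sum>i\<in>{1..7}. real (n i) *\<^sub>R \<alpha> i)"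
    unfolding nonneg_combinations_iff ..
  then have "\<beta> = (\<Sum>i\<in>{1..7}. of_int (- int (n i)) *\<^sub>R \<alpha> i)"
    by (simp add: sum_negf) (metis minus_minus)
  then show ?thesis by (rule that)
qed

lemma inner_simple_V:
  "V k b2 b3 b4 b5 b6 b7 \<bullet> \<alpha> 1 = half_norm * ((k - (b2 + b3 + b4 + b5 + b6 - b7)) / 2)"
  "V k b2 b3 b4 b5 b6 b7 \<bullet> \<alpha> 2 = half_norm * (b6 + b7)"
  "V k b2 b3 b4 b5 b6 b7 \<bullet> \<alpha> 3 = half_norm * (b6 - b7)"
  "V k b2 b3 b4 b5 b6 b7 \<bullet> \<alpha> 4 = half_norm * (b5 - b6)"
  "V k b2 b3 b4 b5 b6 b7 \<bullet> \<alpha> 5 = half_norm * (b4 - b5)"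
  "V k b2 b3 b4 b5 b6 b7 \<bullet> \<alpha> 6 = half_norm * (b3 - b4)"
  "V k b2 b3 b4 b5 b6 b7 \<bullet> \<alpha> 7 = half_norm * (b2 - b3)"
  unfolding simple_V inner_V by (simp_all add: field_simps)

text \<open>
  If a root \<open>\<beta>\<close> has \<open>q\<close> times the norm of the simple roots, then \<open>\<beta> / q\<close> is a weight of
  (normalised) norm \<open>2 / q\<close>, whereas every nonzero weight has norm at least \<open>3 / 2\<close>.
\<close>

lemma root_norm_scaled:
  assumes "\<beta> \<in> \<Phi>"
  shows "\<beta> \<bullet> \<beta> = 2 * half_norm"
proof -
  obtain n where n: "\<beta> = (\<Sum>i\<in>{1..7}. of_int (n i) *\<^sub>R \<alpha> i)"
    using root_integer_combination[OF assms] .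
  \<comment> \<open>Half the quadratic form of the Cartan matrix at \<open>n\<close>; it is an
    integer, and positive because the inner product is.\<close>
  define q where "q = n 1 * n 1 + n 2 * n 2 + n 3 * n 3 + n 4 * n 4 + n 5 * n 5 + n 6 * n 6
    + n 7 * n 7 - n 1 * n 3 - n 3 * n 4 - n 4 * n 5 - n 5 * n 6 - n 6 * n 7 - n 2 * n 4"
  obtain k b2 b3 b4 b5 b6 b7 where b: "\<beta> = V k b2 b3 b4 b5 b6 b7"
    by (rule V_exists)
  have b_eq: "k = n 1" "b2 = n 7 - n 1 / 2" "b3 = n 6 - n 7 - n 1 / 2" "b4 = n 5 - n 6 - n 1 / 2"
    "b5 = n 4 - n 5 - n 1 / 2" "b6 = n 2 + n 3 - n 4 - n 1 / 2" "b7 = n 2 - n 3 + n 1 / 2"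
    using n unfolding b sum_simple_V V_eq_iff by simp_all
  have L: "k * k / 2 + b2 * b2 + b3 * b3 + b4 * b4 + b5 * b5 + b6 * b6 + b7 * b7 = 2 * q"
    unfolding b_eq q_def by (simp add: field_simps)
  have norm: "\<beta> \<bullet> \<beta> = 2 * half_norm * q"
    using L unfolding b inner_V by simp
  moreover have "\<beta> \<bullet> \<beta> > 0"
    using assms zero_not_root by auto
  ultimately have q: "q \<ge> 1"
    using half_norm_pos by (simp add: zero_less_mult_iff)
  have "q = 1"
  proof (rule ccontr)
    assume "q \<noteq> 1"
    then have q2: "real_of_int q \<ge> 2" using q by linarith
    define r where "r = 1 / real_of_int q"
    \<comment> \<open>Up to the factor \<open>half_norm\<close>, \<open>r *\<^sub>R \<beta>\<close>
      is the coroot of \<beta>, so integrality of the pairing of \<alpha> i with this coroot makes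
      it satisfy the weight conditions.\<close>
    have int: "r * ((\<beta> \<bullet> \<alpha> i) / half_norm) \<in> \<int>" if "i \<in> {1..7}" for i
      using coroot_integral[OF assms simple_root[OF that]] half_norm_pos q
      by (simp add: coroot_def norm inner_commute r_def field_simps)
    have "r * ((k - (b2 + b3 + b4 + b5 + b6 - b7)) / 2) \<in> \<int>" "r * (b6 + b7) \<in> \<int>"
      "r * (b6 - b7) \<in> \<int>" "r * (b5 - b6) \<in> \<int>" "r * (b4 - b5) \<in> \<int>" "r * (b3 - b4) \<in> \<int>"
      "r * (b2 - b3) \<in> \<int>"
      using int[of 1] int[of 2] int[of 3] int[of 4] int[of 5] int[of 6] int[of 7] half_norm_pos
      by (simp_all add: b inner_simple_V)
    note r_int = this
    have "r * k = 0 \<and> r * b2 = 0 \<and> r * b3 = 0 \<and> r * b4 = 0 \<and>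
      r * b5 = 0 \<and> r * b6 = 0 \<and> r * b7 = 0"
    proof (rule E7_weight_norm_ge)
      have "r * k * (r * k) / 2 + r * b2 * (r * b2) + r * b3 * (r * b3) + r * b4 * (r * b4) +
          r * b5 * (r * b5) + r * b6 * (r * b6) + r * b7 * (r * b7) = r * r * (2 * q)"
        unfolding L[symmetric] by (simp add: algebra_simps)
      \<comment> \<open>The left side equals \<open>2 / q\<close>, which is at most 1.\<close>
      also have "\<dots> < 3 / 2" using q2 by (simp add: r_def field_simps)
      finally show "r * k * (r * k) / 2 + r * b2 * (r * b2) + r * b3 * (r * b3) + r * b4 * (r * b4) +
          r * b5 * (r * b5) + r * b6 * (r * b6) + r * b7 * (r * b7) < 3 / 2" .
    qed (use r_int in \<open>simp_all add: algebra_simps\<close>)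
    then have "\<beta> = 0" using q by (simp add: r_def b V_eq_0_iff)
    then show False using assms zero_not_root by blast
  qed
  then show ?thesis using norm by simp
qed

text \<open>All roots have the same length, so all are long and the normalisation applies to any of
  them.\<close>

lemma half_norm_eq_1: "half_norm = 1"
proof -
  obtain \<beta> where "\<beta> \<in> \<Phi>" using roots_nonempty by blast
  moreover from this have "long_root \<Phi> \<beta>"
    using root_norm_scaled by (auto simp: long_root_def norm_eq_sqrt_inner)
  ultimately show ?thesis using root_norm_scaled long_norm by fastforce
qed

lemmas inner_V1 = inner_V[unfolded half_norm_eq_1 mult_1]
lemmas inner_simple_V1 = inner_simple_V[unfolded half_norm_eq_1 mult_1]

lemma root_norm: "\<beta> \<in> \<Phi> \<Longrightarrow> \<beta> \<bullet> \<beta> = 2"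
  using root_norm_scaled half_norm_eq_1 by simp

lemma coroot_root: "\<beta> \<in> \<Phi> \<Longrightarrow> coroot \<beta> = \<beta>"
  by (simp add: coroot_def root_norm)

section \<open>Highest root, alcove and weight lattice\<close>

text \<open>The sum is the reflection of \<beta> in \<gamma>.\<close>

lemma root_add:
  assumes "\<beta> \<in> \<Phi>" "\<gamma> \<in> \<Phi>" "\<beta> \<bullet> \<gamma> = -1"
  shows "\<beta> + \<gamma> \<in> \<Phi>"
  using reflection_root[OF assms(2,1)] assms(3) by (simp add: root_reflection_def coroot_root assms)

lemma root_add_V:
  assumes "V k b2 b3 b4 b5 b6 b7 \<in> \<Phi>" "V k' c2 c3 c4 c5 c6 c7 \<in> \<Phi>"
    "k * k' / 2 + b2 * c2 + b3 * c3 + b4 * c4 + b5 * c5 + b6 * c6 + b7 * c7 = -1"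
  shows "V (k + k') (b2 + c2) (b3 + c3) (b4 + c4) (b5 + c5) (b6 + c6) (b7 + c7) \<in> \<Phi>"
  using root_add[OF assms(1,2)] assms(3) by (simp add: inner_V1 V_add)

definition \<theta> where "\<theta> = V 2 0 0 0 0 0 0"

text \<open>Starting from \<alpha> 2, roots with pairing -1 are added one at a time: first inside D6
  up to its highest root \<open>e2 + e3\<close>, then \<alpha> 1, \<open>e4 + e5\<close>, \<alpha> 3
  and \<alpha> 1 again.\<close>

lemma theta_root: "\<theta> \<in> \<Phi>"
proof -
  have simple: "V 1 (-1/2) (-1/2) (-1/2) (-1/2) (-1/2) (1/2) \<in> \<Phi>" "V 0 0 0 0 0 1 1 \<in> \<Phi>"
    "V 0 0 0 0 0 1 (-1) \<in> \<Phi>" "V 0 0 0 0 1 (-1) 0 \<in> \<Phi>" "V 0 0 0 1 (-1) 0 0 \<in> \<Phi>"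
    "V 0 0 1 (-1) 0 0 0 \<in> \<Phi>" "V 0 1 (-1) 0 0 0 0 \<in> \<Phi>"
    using simple_root[of 1] simple_root[of 2] simple_root[of 3] simple_root[of 4]
      simple_root[of 5] simple_root[of 6] simple_root[of 7]
    by (simp_all add: simple_V)
  have "V 0 0 0 0 1 0 1 \<in> \<Phi>" using root_add_V[OF simple(2) simple(4)] by simp
  from root_add_V[OF this simple(3)] have "V 0 0 0 0 1 1 0 \<in> \<Phi>" by simp
  from root_add_V[OF this simple(5)] have "V 0 0 0 1 0 1 0 \<in> \<Phi>" by simp
  from root_add_V[OF this simple(4)] have r45: "V 0 0 0 1 1 0 0 \<in> \<Phi>" by simp
  from root_add_V[OF this simple(6)] have "V 0 0 1 0 1 0 0 \<in> \<Phi>" by simp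
  from root_add_V[OF this simple(7)] have "V 0 1 0 0 1 0 0 \<in> \<Phi>" by simp
  from root_add_V[OF this simple(5)] have "V 0 1 0 1 0 0 0 \<in> \<Phi>" by simp
  from root_add_V[OF this simple(6)] have "V 0 1 1 0 0 0 0 \<in> \<Phi>" by simp
  from root_add_V[OF this simple(1)] have "V 1 (1/2) (1/2) (-1/2) (-1/2) (-1/2) (1/2) \<in> \<Phi>" by simp
  from root_add_V[OF this r45] have "V 1 (1/2) (1/2) (1/2) (1/2) (-1/2) (1/2) \<in> \<Phi>" by simp
  from root_add_V[OF this simple(3)] have "V 1 (1/2) (1/2) (1/2) (1/2) (1/2) (-1/2) \<in> \<Phi>" by simp
  from root_add_V[OF this simple(1)] show ?thesis by (simp add: \<theta>_def)
qed

text \<open>Cauchy-Schwarz with \<beta> of norm 2 bounds the square of \<open>n\<close> by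
  \<open>2 * (\<omega> \<bullet> \<omega>)\<close>. Because \<open>n\<close> is an integer, it is
  enough that this lies below the square of \<open>t + 1\<close> rather than of
  \<open>t\<close>.\<close>

lemma root_inner_le:
  fixes n :: int and t :: nat
  assumes "\<beta> \<in> \<Phi>" "\<beta> \<bullet> \<omega> = of_int n" "2 * (\<omega> \<bullet> \<omega>) < (real t + 1)\<^sup>2"
  shows "n \<le> int t"
proof (rule ccontr)
  assume "\<not> n \<le> int t"
  then have "real t + 1 \<le> of_int n" by linarith
  then have "(real t + 1)\<^sup>2 \<le> (of_int n)\<^sup>2" by (intro power_mono) auto
  also have "\<dots> \<le> 2 * (\<omega> \<bullet> \<omega>)"
    using Cauchy_Schwarz_ineq[of \<beta> \<omega>] assms(1,2) by (simp add: root_norm)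
  finally show False using assms(3) by simp
qed

text \<open>
  The coefficient of a root at \<open>\<alpha> i\<close> is its inner product with the \<open>i\<close>-th fundamental weight; in
  type \<open>E\<^sub>7\<close> rounding down the Cauchy-Schwarz bound gives exactly the coefficients of \<open>\<theta>\<close>.
\<close>

lemma theta_minus_root:
  assumes "\<beta> \<in> \<Phi>"
  shows "\<theta> - \<beta> \<in> nonneg_combinations \<Delta>"
proof -
  obtain n where n: "\<beta> = (\<Sum>i\<in>{1..7}. of_int (n i) *\<^sub>R \<alpha> i)"
    using root_integer_combination[OF assms] .
  note bound = root_inner_le[OF assms, unfolded n sum_simple_V]
  have le: "n 1 \<le> 2" "n 2 \<le> 2" "n 3 \<le> 3" "n 4 \<le> 4" "n 5 \<le> 3" "n 6 \<le> 2" "n 7 \<le> 1"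
    \<comment> \<open>The seven vectors are the fundamental weights in Bourbaki order.\<close>
    using bound[of "V 2 0 0 0 0 0 0" "n 1" 2]
      bound[of "V 2 (1/2) (1/2) (1/2) (1/2) (1/2) (1/2)" "n 2" 2]
      bound[of "V 3 (1/2) (1/2) (1/2) (1/2) (1/2) (-1/2)" "n 3" 3]
      bound[of "V 4 1 1 1 1 0 0" "n 4" 4] bound[of "V 3 1 1 1 0 0 0" "n 5" 3]
      bound[of "V 2 1 1 0 0 0 0" "n 6" 2] bound[of "V 1 1 0 0 0 0 0" "n 7" 1]
    by (simp_all add: inner_V1 power2_eq_square field_simps)
  define c where "c i = ((\<lambda>_. 0)(1 := 2, 2 := 2, 3 := 3, 4 := 4, 5 := 3, 6 := 2, 7 := 1::int)) i - n i"
    for i :: nat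
  have c: "c 1 = 2 - n 1" "c 2 = 2 - n 2" "c 3 = 3 - n 3" "c 4 = 4 - n 4" "c 5 = 3 - n 5"
    "c 6 = 2 - n 6" "c 7 = 1 - n 7"
    by (simp_all add: c_def)
  have "\<theta> - \<beta> = (\<Sum>i\<in>{1..7}. of_int (c i) *\<^sub>R \<alpha> i)"
    unfolding n sum_simple_V \<theta>_def V_diff V_eq_iff c by (simp add: field_simps)
  also have "\<dots> = (\<Sum>i\<in>{1..7}. real (nat (c i)) *\<^sub>R \<alpha> i)"
  proof (intro sum.cong refl)
    fix i :: nat assume "i \<in> {1..7}"
    then have "c i \<ge> 0" using le unfolding interval_7 by (auto simp: c)
    then show "of_int (c i) *\<^sub>R \<alpha> i = real (nat (c i)) *\<^sub>R \<alpha> i" by simp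
  qed
  finally show ?thesis
    unfolding nonneg_combinations_iff by (intro exI[of _ "\<lambda>i. nat (c i)"])
qed

text \<open>The two combinations add up to zero; independence of the simple roots makes every
  \<open>n i + n' i\<close> vanish, hence both summands. This gives uniqueness of the highest
  root.\<close>

lemma nonneg_combinations_antisym:
  assumes "x - y \<in> nonneg_combinations \<Delta>" "y - x \<in> nonneg_combinations \<Delta>"
  shows "x = y"
proof -
  obtain n :: "nat \<Rightarrow> nat" where n: "x - y = (\<Sum>i\<in>{1..7}. real (n i) *\<^sub>R \<alpha> i)"
    using assms(1) unfolding nonneg_combinations_iff by blast
  obtain n' :: "nat \<Rightarrow> nat" where n': "y - x = (\<Sum>i\<in>{1..7}. real (n' i) *\<^sub>R \<alpha> i)"
    using assms(2) unfolding nonneg_combinations_iff by blast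
  have "(\<Sum>i\<in>{1..7}. real (n i + n' i) *\<^sub>R \<alpha> i) = (x - y) + (y - x)"
    unfolding n n' by (simp add: scaleR_add_left sum.distrib)
  also have "\<dots> = 0" by simp
  finally have z: "(\<Sum>i\<in>{1..7}. real (n i + n' i) *\<^sub>R \<alpha> i) = 0" .
  define s where "s i = real (n i + n' i)" for i
  have "s 1 = 0" "s 7 = 0" "s 6 = 0" "s 5 = 0" "s 4 = 0" "s 3 = 0" "s 2 = 0"
    using z[folded s_def] unfolding sum_simple_V V_eq_0_iff by auto
  then have "n 1 = 0" "n 2 = 0" "n 3 = 0" "n 4 = 0" "n 5 = 0" "n 6 = 0" "n 7 = 0"
    by (simp_all add: s_def)
  then have "x - y = 0" unfolding n interval_7 by simp
  then show ?thesis by simp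
qed

lemma highest_root_eq: "highest_root \<Phi> \<Delta> = \<theta>"
  unfolding highest_root_def
  using theta_root theta_minus_root nonneg_combinations_antisym by (intro the_equality) auto

text \<open>Every root equals its coroot and is an integer combination of simple roots, so seven
  tests decide integrality on the coroot lattice.\<close>

lemma weight_lattice_iff: "x \<in> weight_lattice \<Phi> \<longleftrightarrow> (\<forall>i\<in>{1..7}. x \<bullet> \<alpha> i \<in> \<int>)"
proof
  assume x: "x \<in> weight_lattice \<Phi>"
  show "\<forall>i\<in>{1..7}. x \<bullet> \<alpha> i \<in> \<int>"
  proof
    fix i :: nat assume i: "i \<in> {1..7}"
    define c :: "'a \<Rightarrow> int" where "c \<beta> = (if \<beta> = \<alpha> i then 1 else 0)" for \<beta>
    have "(\<Sum>\<beta>\<in>\<Phi>. of_int (c \<beta>) *\<^sub>R coroot \<beta>) = (\<Sum>\<beta>\<in>\<Phi>. if \<beta> = \<alpha> i then coroot \<beta> else 0)"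
      by (intro sum.cong) (auto simp: c_def)
    also have "\<dots> = \<alpha> i"
      using simple_root[OF i] finite_roots by (simp add: coroot_root)
    finally have "\<alpha> i = (\<Sum>\<beta>\<in>\<Phi>. of_int (c \<beta>) *\<^sub>R coroot \<beta>)" ..
    then have "\<alpha> i \<in> coroot_lattice \<Phi>"
      unfolding coroot_lattice_def by blast
    then show "x \<bullet> \<alpha> i \<in> \<int>" using x unfolding weight_lattice_def by blast
  qed
next
  assume x: "\<forall>i\<in>{1..7}. x \<bullet> \<alpha> i \<in> \<int>"
  have root: "x \<bullet> \<beta> \<in> \<int>" if \<beta>: "\<beta> \<in> \<Phi>" for \<beta>
  proof -
    obtain n where n: "\<beta> = (\<Sum>i\<in>{1..7}. of_int (n i) *\<^sub>R \<alpha> i)"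
      using root_integer_combination[OF \<beta>] .
    show ?thesis
      unfolding n inner_sum_right inner_scaleR_right using x by (intro Ints_sum Ints_mult) auto
  qed
  show "x \<in> weight_lattice \<Phi>"
    unfolding weight_lattice_def coroot_lattice_def
    by (auto simp: inner_sum_right coroot_root root intro!: Ints_sum Ints_mult)
qed

lemma weyl_chamber_eq: "weyl_chamber \<Phi> \<Delta> = {x. \<forall>i\<in>{1..7}. 0 \<le> x \<bullet> \<alpha> i}"
proof (intro equalityI subsetI)
  fix x assume x: "x \<in> weyl_chamber \<Phi> \<Delta>"
  have "\<alpha> i \<in> positive_roots \<Phi> \<Delta>" if i: "i \<in> {1..7}" for i
  proof -
    have "\<alpha> i = (\<Sum>j\<in>{1..7}. real (if j = i then 1 else 0) *\<^sub>R \<alpha> j)"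
      using i by (simp add: if_distrib[of real] if_distrib[of "\<lambda>r. r *\<^sub>R _"] cong: if_cong)
    then show ?thesis
      unfolding positive_roots_def Int_iff nonneg_combinations_iff
      using simple_root[OF i] by (intro conjI exI[of _ "\<lambda>j. if j = i then 1 else 0"])
  qed
  then show "x \<in> {x. \<forall>i\<in>{1..7}. 0 \<le> x \<bullet> \<alpha> i}"
    using x unfolding weyl_chamber_def by blast
next
  fix x assume "x \<in> {x. \<forall>i\<in>{1..7}. 0 \<le> x \<bullet> \<alpha> i}"
  then show "x \<in> weyl_chamber \<Phi> \<Delta>"
    unfolding weyl_chamber_def positive_roots_def
    by (auto simp: nonneg_combinations_iff inner_sum_right intro!: sum_nonneg)
qed

text \<open>The alcove is a finite intersection of closed half-spaces with nonzero normals, and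
  interiors commute with finite intersections.\<close>

lemma interior_alcove:
  "interior (alcove \<Phi> \<Delta> m) = {x. (\<forall>i\<in>{1..7}. 0 < x \<bullet> \<alpha> i) \<and> \<theta> \<bullet> x < real m}"
proof -
  have "\<theta> \<noteq> 0" using theta_root zero_not_root by metis
  have "alcove \<Phi> \<Delta> m = {x. \<alpha> 1 \<bullet> x \<ge> 0} \<inter> {x. \<alpha> 2 \<bullet> x \<ge> 0} \<inter> {x. \<alpha> 3 \<bullet> x \<ge> 0} \<inter>
      {x. \<alpha> 4 \<bullet> x \<ge> 0} \<inter> {x. \<alpha> 5 \<bullet> x \<ge> 0} \<inter> {x. \<alpha> 6 \<bullet> x \<ge> 0} \<inter> {x. \<alpha> 7 \<bullet> x \<ge> 0} \<inter>
      {x. \<theta> \<bullet> x \<le> real m}"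
    unfolding alcove_def weyl_chamber_eq highest_root_eq interval_7 by (auto simp: inner_commute)
  moreover have "\<alpha> 1 \<noteq> 0" "\<alpha> 2 \<noteq> 0" "\<alpha> 3 \<noteq> 0" "\<alpha> 4 \<noteq> 0" "\<alpha> 5 \<noteq> 0" "\<alpha> 6 \<noteq> 0" "\<alpha> 7 \<noteq> 0"
    using simple_nonzero by simp_all
  ultimately have "interior (alcove \<Phi> \<Delta> m) = {x. \<alpha> 1 \<bullet> x > 0} \<inter> {x. \<alpha> 2 \<bullet> x > 0} \<inter>
      {x. \<alpha> 3 \<bullet> x > 0} \<inter> {x. \<alpha> 4 \<bullet> x > 0} \<inter> {x. \<alpha> 5 \<bullet> x > 0} \<inter> {x. \<alpha> 6 \<bullet> x > 0} \<inter>
      {x. \<alpha> 7 \<bullet> x > 0} \<inter> {x. \<theta> \<bullet> x < real m}"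
    using \<open>\<theta> \<noteq> 0\<close> by simp
  then show ?thesis
    unfolding interval_7 by (auto simp: inner_commute)
qed

lemma regular_weights_eq:
  "regular_weights \<Phi> \<Delta> m =
     {x \<in> weight_lattice \<Phi>. (\<forall>i\<in>{1..7}. 0 < x \<bullet> \<alpha> i) \<and> \<theta> \<bullet> x < real m}"
  unfolding regular_weights_def interior_alcove by blast

section \<open>Counting lattice points\<close>

lemma weight_lattice_V_iff:
  "V k b2 b3 b4 b5 b6 b7 \<in> weight_lattice \<Phi> \<longleftrightarrow>
    (k - (b2 + b3 + b4 + b5 + b6 - b7)) / 2 \<in> \<int> \<and> b6 + b7 \<in> \<int> \<and> b6 - b7 \<in> \<int> \<and>
      b5 - b6 \<in> \<int> \<and> b4 - b5 \<in> \<int> \<and> b3 - b4 \<in> \<int> \<and> b2 - b3 \<in> \<int>"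
  unfolding weight_lattice_iff interval_7 by (simp add: inner_simple_V1)

lemma weight_lattice_scaleR:
  "x \<in> weight_lattice \<Phi> \<Longrightarrow> real n *\<^sub>R x \<in> weight_lattice \<Phi>"
  unfolding weight_lattice_iff by (simp add: Ints_mult)

text \<open>The root lattice, encoded through its pairings with weights because the denominator
  condition produces it in this form.\<close>

definition dual_lattice :: "'a set" where
  "dual_lattice = {x. \<forall>w\<in>weight_lattice \<Phi>. w \<bullet> x \<in> \<int>}"

text \<open>The coefficients of the \<open>w \<bullet> \<alpha> i\<close> are the inner products with the fundamental weights.\<close>

lemma inner_V_expansion:
  "w \<bullet> V k b2 b3 b4 b5 b6 b7 =
     (w \<bullet> \<alpha> 1) * k + (w \<bullet> \<alpha> 2) * (k + (b2 + b3 + b4 + b5 + b6 + b7) / 2) +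
     (w \<bullet> \<alpha> 3) * (3 * k / 2 + (b2 + b3 + b4 + b5 + b6 - b7) / 2) +
     (w \<bullet> \<alpha> 4) * (2 * k + b2 + b3 + b4 + b5) + (w \<bullet> \<alpha> 5) * (3 * k / 2 + b2 + b3 + b4) +
     (w \<bullet> \<alpha> 6) * (k + b2 + b3) + (w \<bullet> \<alpha> 7) * (k / 2 + b2)"
proof -
  obtain l c2 c3 c4 c5 c6 c7 where w: "w = V l c2 c3 c4 c5 c6 c7" by (rule V_exists)
  show ?thesis unfolding w inner_V1 inner_simple_V1 by (simp add: field_simps)
qed

text \<open>The right side says that the coefficients in the simple roots are integers. Necessity
  follows by pairing with the fundamental weights, sufficiency from
  \<open>inner_V_expansion\<close>.\<close>

lemma dual_lattice_V_iff:
  "V k b2 b3 b4 b5 b6 b7 \<in> dual_lattice \<longleftrightarrow>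
    k \<in> \<int> \<and> k + (b2 + b3 + b4 + b5 + b6 + b7) / 2 \<in> \<int> \<and>
      3 * k / 2 + (b2 + b3 + b4 + b5 + b6 - b7) / 2 \<in> \<int> \<and> 2 * k + b2 + b3 + b4 + b5 \<in> \<int> \<and>
      3 * k / 2 + b2 + b3 + b4 \<in> \<int> \<and> k + b2 + b3 \<in> \<int> \<and> k / 2 + b2 \<in> \<int>" (is "?L \<longleftrightarrow> ?R")
proof
  assume ?L
  then have dual: "w \<bullet> V k b2 b3 b4 b5 b6 b7 \<in> \<int>" if "w \<in> weight_lattice \<Phi>" for w
    using that unfolding dual_lattice_def by blast
  have "V 2 0 0 0 0 0 0 \<in> weight_lattice \<Phi>"
    "V 2 (1/2) (1/2) (1/2) (1/2) (1/2) (1/2) \<in> weight_lattice \<Phi>"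
    "V 3 (1/2) (1/2) (1/2) (1/2) (1/2) (-1/2) \<in> weight_lattice \<Phi>"
    "V 4 1 1 1 1 0 0 \<in> weight_lattice \<Phi>" "V 3 1 1 1 0 0 0 \<in> weight_lattice \<Phi>"
    "V 2 1 1 0 0 0 0 \<in> weight_lattice \<Phi>" "V 1 1 0 0 0 0 0 \<in> weight_lattice \<Phi>"
    by (simp_all add: weight_lattice_V_iff)
  from this[THEN dual] show ?R
    by (simp add: inner_V1 add_divide_distrib diff_divide_distrib algebra_simps)
next
  assume R: ?R
  show ?L
    unfolding dual_lattice_def
  proof (intro CollectI ballI)
    fix w assume "w \<in> weight_lattice \<Phi>"
    then have "w \<bullet> \<alpha> i \<in> \<int>" if "i \<in> {1..7}" for i
      using that unfolding weight_lattice_iff by blast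
    then have "w \<bullet> \<alpha> 1 \<in> \<int>" "w \<bullet> \<alpha> 2 \<in> \<int>" "w \<bullet> \<alpha> 3 \<in> \<int>" "w \<bullet> \<alpha> 4 \<in> \<int>"
      "w \<bullet> \<alpha> 5 \<in> \<int>" "w \<bullet> \<alpha> 6 \<in> \<int>" "w \<bullet> \<alpha> 7 \<in> \<int>"
      by simp_all
    then show "w \<bullet> V k b2 b3 b4 b5 b6 b7 \<in> \<int>"
      unfolding inner_V_expansion using R by (simp only: Ints_add Ints_mult)
  qed
qed

section \<open>Root lattice between twice the weight lattice and the weight lattice\<close>

lemma simple_root_in_weight_lattice: "i \<in> {1..7} \<Longrightarrow> \<alpha> i \<in> weight_lattice \<Phi>"
  unfolding weight_lattice_iff using coroot_integral simple_root coroot_root by metis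

lemma dual_lattice_subset_weight_lattice: "dual_lattice \<subseteq> weight_lattice \<Phi>"
  unfolding dual_lattice_def weight_lattice_iff subset_iff mem_Collect_eq
  using simple_root_in_weight_lattice by (metis inner_commute)

lemma double_weight_in_dual_lattice:
  assumes "x \<in> weight_lattice \<Phi>"
  shows "2 *\<^sub>R x \<in> dual_lattice"
proof -
  obtain k b2 b3 b4 b5 b6 b7 where x: "x = V k b2 b3 b4 b5 b6 b7" by (rule V_exists)
  have "(k - (b2 + b3 + b4 + b5 + b6 - b7)) / 2 \<in> \<int>" "b6 + b7 \<in> \<int>" "b6 - b7 \<in> \<int>"
    "b5 - b6 \<in> \<int>" "b4 - b5 \<in> \<int>" "b3 - b4 \<in> \<int>" "b2 - b3 \<in> \<int>"
    using assms unfolding x weight_lattice_V_iff by blast+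
  then obtain x1 x2 x3 x4 x5 x6 x7 where
    xi: "(k - (b2 + b3 + b4 + b5 + b6 - b7)) / 2 = of_int x1" "b6 + b7 = of_int x2"
      "b6 - b7 = of_int x3" "b5 - b6 = of_int x4" "b4 - b5 = of_int x5" "b3 - b4 = of_int x6"
      "b2 - b3 = of_int x7"
    by (elim Ints_cases) blast
  \<comment> \<open>The coefficients form twice the inverse Cartan matrix, which is integral since
    the Cartan matrix of E7 has determinant 2.\<close>
  have "2 * k = of_int (4 * x1 + 4 * x2 + 6 * x3 + 8 * x4 + 6 * x5 + 4 * x6 + 2 * x7)"
    "2 * k + (2 * b2 + 2 * b3 + 2 * b4 + 2 * b5 + 2 * b6 + 2 * b7) / 2 =
      of_int (4 * x1 + 7 * x2 + 8 * x3 + 12 * x4 + 9 * x5 + 6 * x6 + 3 * x7)"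
    "3 * (2 * k) / 2 + (2 * b2 + 2 * b3 + 2 * b4 + 2 * b5 + 2 * b6 - 2 * b7) / 2 =
      of_int (6 * x1 + 8 * x2 + 12 * x3 + 16 * x4 + 12 * x5 + 8 * x6 + 4 * x7)"
    "2 * (2 * k) + 2 * b2 + 2 * b3 + 2 * b4 + 2 * b5 =
      of_int (8 * x1 + 12 * x2 + 16 * x3 + 24 * x4 + 18 * x5 + 12 * x6 + 6 * x7)"
    "3 * (2 * k) / 2 + 2 * b2 + 2 * b3 + 2 * b4 =
      of_int (6 * x1 + 9 * x2 + 12 * x3 + 18 * x4 + 15 * x5 + 10 * x6 + 5 * x7)"
    "2 * k + 2 * b2 + 2 * b3 =
      of_int (4 * x1 + 6 * x2 + 8 * x3 + 12 * x4 + 10 * x5 + 8 * x6 + 4 * x7)"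
    "2 * k / 2 + 2 * b2 = of_int (2 * x1 + 3 * x2 + 4 * x3 + 6 * x4 + 5 * x5 + 4 * x6 + 3 * x7)"
    unfolding of_int_add of_int_mult of_int_numeral xi[symmetric] by (simp_all add: field_simps)
  from this[THEN Ints_I] show ?thesis
    unfolding x V_scaleR dual_lattice_V_iff by blast
qed

lemma weight_inner_half_integral:
  assumes "w \<in> weight_lattice \<Phi>" "a \<in> weight_lattice \<Phi>"
  shows "2 * (w \<bullet> a) \<in> \<int>"
  using double_weight_in_dual_lattice[OF assms(2)] assms(1) by (simp add: dual_lattice_def)

text \<open>Pairings of weights are only half-integral. Here 2 is prime to \<open>p\<close>, so the
  fraction is expanded by 2 and the extra factor joins \<open>r\<close>.\<close>

lemma denominators_odd_prime:
  assumes p: "prime p" "p > 2" "\<not> p dvd r" and a: "a \<in> weight_lattice \<Phi>"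
  shows "(\<forall>w\<in>weight_lattice \<Phi>. denominator_is_power ((w \<bullet> a) / real (p ^ i * r)) p) \<longleftrightarrow>
    (1 / real r) *\<^sub>R a \<in> dual_lattice"
proof -
  have "\<not> p dvd 2 * r"
    using p by (metis dvd_imp_le not_le pos2 prime_dvd_mult_iff)
  from denominator_is_power_divide_iff[OF p(1) this weight_inner_half_integral[OF _ a], of _ i]
  have "denominator_is_power ((w \<bullet> a) / real (p ^ i * r)) p \<longleftrightarrow> (w \<bullet> a) / real r \<in> \<int>"
    if "w \<in> weight_lattice \<Phi>" for w using that by simp
  then show ?thesis unfolding dual_lattice_def by simp
qed

text \<open>Now the factor 2 from half-integrality joins the power of \<open>p\<close>, whence the
  exponent \<open>Suc i\<close>. What remains is integrality of
  \<open>2 * (w \<bullet> a) / r\<close>, weaker than membership in the root lattice.\<close>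

lemma denominators_2:
  assumes r: "odd r" and a: "a \<in> weight_lattice \<Phi>"
  shows "(\<forall>w\<in>weight_lattice \<Phi>. denominator_is_power ((w \<bullet> a) / real (2 ^ i * r)) 2) \<longleftrightarrow>
    (1 / real r) *\<^sub>R a \<in> weight_lattice \<Phi>"
proof -
  have "denominator_is_power ((w \<bullet> a) / real (2 ^ i * r)) 2 \<longleftrightarrow> 2 * (w \<bullet> a) / real r \<in> \<int>"
    if "w \<in> weight_lattice \<Phi>" for w
    using denominator_is_power_divide_iff[OF two_is_prime_nat r weight_inner_half_integral[OF that a], of "Suc i"]
    by simp
  then have "(\<forall>w\<in>weight_lattice \<Phi>. denominator_is_power ((w \<bullet> a) / real (2 ^ i * r)) 2) \<longleftrightarrow>
      (\<forall>w\<in>weight_lattice \<Phi>. 2 * (w \<bullet> a) / real r \<in> \<int>)" by blast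
  also have "\<dots> \<longleftrightarrow> (1 / real r) *\<^sub>R a \<in> weight_lattice \<Phi>"
  proof
    assume L: "\<forall>w\<in>weight_lattice \<Phi>. 2 * (w \<bullet> a) / real r \<in> \<int>"
    show "(1 / real r) *\<^sub>R a \<in> weight_lattice \<Phi>"
      unfolding weight_lattice_iff
    proof
      fix j :: nat assume j: "j \<in> {1..7}"
      \<comment> \<open>With \<open>r - 2 * s = 1\<close>, the quotient of
        \<open>a \<bullet> \<alpha> j\<close> by \<open>r\<close> is an integer combination of
        \<open>a \<bullet> \<alpha> j\<close> and twice that quotient.\<close>
      obtain s where s: "r = 2 * s + 1" using r by (rule oddE)
      have "\<alpha> j \<in> weight_lattice \<Phi>"
        using j by (rule simple_root_in_weight_lattice)
      then have "2 * (\<alpha> j \<bullet> a) / real r \<in> \<int>" using L by blast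
      moreover have "a \<bullet> \<alpha> j \<in> \<int>" using a j unfolding weight_lattice_iff by blast
      ultimately have "a \<bullet> \<alpha> j - of_nat s * (2 * (\<alpha> j \<bullet> a) / real r) \<in> \<int>"
        by (intro Ints_diff Ints_mult) auto
      also have "a \<bullet> \<alpha> j - of_nat s * (2 * (\<alpha> j \<bullet> a) / real r) = ((1 / real r) *\<^sub>R a) \<bullet> \<alpha> j"
        by (simp add: s inner_commute field_simps)
      finally show "((1 / real r) *\<^sub>R a) \<bullet> \<alpha> j \<in> \<int>" .
    qed
  next
    assume "(1 / real r) *\<^sub>R a \<in> weight_lattice \<Phi>"
    then show "\<forall>w\<in>weight_lattice \<Phi>. 2 * (w \<bullet> a) / real r \<in> \<int>"
      using weight_inner_half_integral by fastforce
  qed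
  finally show ?thesis .
qed

text \<open>Scaling by \<open>r\<close> carries the open alcove of level \<open>p ^ i\<close> onto
  that of level \<open>p ^ i * r\<close>. The lattice \<open>L\<close> will be the weight lattice
  for \<open>p = 2\<close> and \<open>dual_lattice\<close> for odd \<open>p\<close>.\<close>

lemma N_eq_card_lattice_points:
  assumes r: "r > 0" and p: "p > 0" and L: "L \<subseteq> weight_lattice \<Phi>"
    and denominators: "\<And>a. a \<in> weight_lattice \<Phi> \<Longrightarrow>
      (\<forall>w\<in>weight_lattice \<Phi>. denominator_is_power ((w \<bullet> a) / real (p ^ i * r)) p) \<longleftrightarrow>
        (1 / real r) *\<^sub>R a \<in> L"
  shows "N \<Phi> \<Delta> (p ^ i * r) p =
    card {x \<in> L. (\<forall>i\<in>{1..7}. 0 < x \<bullet> \<alpha> i) \<and> \<theta> \<bullet> x < real (p ^ i)}" (is "_ = card ?X")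
proof -
  have "bij_betw (\<lambda>x. real r *\<^sub>R x) ?X
      {a \<in> regular_weights \<Phi> \<Delta> (p ^ i * r). \<forall>w\<in>weight_lattice \<Phi>.
        denominator_is_power ((w \<bullet> a) / real (p ^ i * r)) p}" (is "bij_betw _ _ ?A")
  proof (rule bij_betw_byWitness[where f' = "\<lambda>a. (1 / real r) *\<^sub>R a"])
    have less: "r * y < real p ^ i * r \<longleftrightarrow> y < real p ^ i" for y
      using r by (simp add: mult.commute)
    show "(\<lambda>x. real r *\<^sub>R x) ` ?X \<subseteq> ?A"
    proof clarify
      fix x assume x: "x \<in> L" "\<forall>i\<in>{1..7}. 0 < x \<bullet> \<alpha> i" "\<theta> \<bullet> x < real (p ^ i)"
      then have rx: "real r *\<^sub>R x \<in> weight_lattice \<Phi>"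
        using L weight_lattice_scaleR by blast
      moreover have "(1 / real r) *\<^sub>R (real r *\<^sub>R x) \<in> L"
        using r x(1) by simp
      ultimately have "\<forall>w\<in>weight_lattice \<Phi>.
          denominator_is_power ((w \<bullet> (real r *\<^sub>R x)) / real (p ^ i * r)) p"
        using denominators by blast
      moreover have "real r *\<^sub>R x \<in> regular_weights \<Phi> \<Delta> (p ^ i * r)"
        using rx x(2,3) r less by (simp add: regular_weights_eq)
      ultimately show "real r *\<^sub>R x \<in> regular_weights \<Phi> \<Delta> (p ^ i * r) \<and> (\<forall>w\<in>weight_lattice \<Phi>.
          denominator_is_power ((w \<bullet> (real r *\<^sub>R x)) / real (p ^ i * r)) p)"
        by blast
    qed
    show "(\<lambda>a. (1 / real r) *\<^sub>R a) ` ?A \<subseteq> ?X"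
    proof clarify
      fix a assume a: "a \<in> regular_weights \<Phi> \<Delta> (p ^ i * r)"
        "\<forall>w\<in>weight_lattice \<Phi>. denominator_is_power ((w \<bullet> a) / real (p ^ i * r)) p"
      then have "(1 / real r) *\<^sub>R a \<in> L"
        using denominators by (simp add: regular_weights_eq)
      then show "(1 / real r) *\<^sub>R a \<in> L \<and> (\<forall>i\<in>{1..7}. 0 < ((1 / real r) *\<^sub>R a) \<bullet> \<alpha> i) \<and>
          \<theta> \<bullet> ((1 / real r) *\<^sub>R a) < real (p ^ i)"
        using a(1) r by (simp add: regular_weights_eq field_simps)
    qed
  qed (use r in auto)
  then show ?thesis unfolding N_def by (simp add: bij_betw_same_card)
qed

lemma alcove_V_iff:
  "(\<forall>i\<in>{1..7}. 0 < V k b2 b3 b4 b5 b6 b7 \<bullet> \<alpha> i) \<and> \<theta> \<bullet> V k b2 b3 b4 b5 b6 b7 < M \<longleftrightarrow>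
    b2 > b3 \<and> b3 > b4 \<and> b4 > b5 \<and> b5 > b6 \<and> b6 > \<bar>b7\<bar> \<and> k > b2 + b3 + b4 + b5 + b6 - b7 \<and> M > k"
proof -
  have "\<theta> \<bullet> V k b2 b3 b4 b5 b6 b7 = k" by (simp add: \<theta>_def inner_V1)
  then show ?thesis
    unfolding interval_7 ball_simps inner_simple_V1
    by simp (rule iffI; elim conjE; intro conjI; linarith)
qed

text \<open>The substitution \<open>k = sqrt 2 * b1\<close> makes \<open>V\<close> a bijective
  parametrisation of the space by the tuples of the statement.\<close>

lemma card_V:
  assumes "\<And>k b2 b3 b4 b5 b6 b7. V k b2 b3 b4 b5 b6 b7 \<in> X \<longleftrightarrow> P k b2 b3 b4 b5 b6 b7"
  shows "card X = card {(b1, b2, b3, b4, b5, b6, b7). P (sqrt 2 * b1) b2 b3 b4 b5 b6 b7}"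
    (is "_ = card ?T")
proof -
  define f where "f = (\<lambda>(b1, b2, b3, b4, b5, b6, b7). V (sqrt 2 * b1) b2 b3 b4 b5 b6 b7)"
  have "X \<subseteq> f ` ?T"
  proof
    fix x assume x: "x \<in> X"
    obtain k b2 b3 b4 b5 b6 b7 where V: "x = V k b2 b3 b4 b5 b6 b7" by (rule V_exists)
    show "x \<in> f ` ?T"
      using x by (intro image_eqI[of _ _ "(k / sqrt 2, b2, b3, b4, b5, b6, b7)"])
        (simp_all add: f_def V assms)
  qed
  moreover have "f ` ?T \<subseteq> X" by (auto simp: f_def assms)
  ultimately have X: "X = f ` ?T" by (rule subset_antisym)
  have "inj_on f ?T" by (auto simp: inj_on_def f_def V_eq_iff)
  then show ?thesis unfolding X by (rule card_image)
qed

end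

section \<open>The count in the coordinates of the statement\<close>

lemma tuples_iff:
  "(b1, b2, b3, b4, b5, b6, b7) \<in> tuples \<longleftrightarrow> sqrt 2 * b1 \<in> \<int> \<and>
     ((\<forall>b\<in>{b2, b3, b4, b5, b6, b7}. b \<in> \<int>) \<or> (\<forall>b\<in>{b2, b3, b4, b5, b6, b7}. b - 1/2 \<in> \<int>))"
proof -
  have "b1 = 1 / sqrt 2 * of_int k \<longleftrightarrow> sqrt 2 * b1 = of_int k" for k
    by (simp add: field_simps)
  then have "(\<exists>k. b1 = 1 / sqrt 2 * of_int k) \<longleftrightarrow> sqrt 2 * b1 \<in> \<int>"
    by (auto elim: Ints_cases)
  then show ?thesis unfolding tuples_def by simp
qed

theorem mainTheorem9:
  fixes \<Phi> \<Delta> :: "'a::euclidean_space set" and m m' p i :: nat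
  assumes "simple_root_datum \<Phi> \<Delta>" and "type_E7 \<Delta>"
    and "m > 0" and "prime p"
    and "m = p ^ i * m'" and "\<not> p dvd m'"
  shows
    "(p = 2 \<longrightarrow>
       N \<Phi> \<Delta> m p =
         card {(b1, b2, b3, b4, b5, b6, b7).
                 (b1, b2, b3, b4, b5, b6, b7) \<in> tuples \<and>
                 b2 > b3 \<and> b3 > b4 \<and> b4 > b5 \<and> b5 > b6 \<and> b6 > \<bar>b7\<bar> \<and>
                 sqrt 2 * b1 > b2 + b3 + b4 + b5 + b6 - b7 \<and>
                 real (p ^ i) > sqrt 2 * b1 \<and>
                 [sqrt 2 * b1 + b2 + b3 + b4 + b5 + b6 - b7 = 0] (rmod 2)}) \<and>
     (p > 2 \<longrightarrow>
       N \<Phi> \<Delta> m p =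
         card {(b1, b2, b3, b4, b5, b6, b7).
                 (b1, b2, b3, b4, b5, b6, b7) \<in> tuples \<and>
                 (\<forall>b\<in>{b2, b3, b4, b5, b6, b7}. [2 * b = sqrt 2 * b1] (rmod 2)) \<and>
                 b2 > b3 \<and> b3 > b4 \<and> b4 > b5 \<and> b5 > b6 \<and> b6 > \<bar>b7\<bar> \<and>
                 sqrt 2 * b1 > b2 + b3 + b4 + b5 + b6 - b7 \<and>
                 real (p ^ i) > sqrt 2 * b1 \<and>
                 [b2 + b3 + b4 + b5 + b6 + b7 = 0] (rmod 2)})"
proof -
  obtain \<alpha> :: "nat \<Rightarrow> 'a" where \<alpha>: "bij_betw \<alpha> {1..7} \<Delta>"
    "\<And>i j. i \<in> {1..7} \<Longrightarrow> j \<in> {1..7} \<Longrightarrow>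
      \<alpha> i \<bullet> coroot (\<alpha> j) = (if i = j then 2 else if {i, j} \<in> E7_edges then -1 else 0)"
    using assms(2) unfolding type_E7_def by blast
  interpret E7_datum \<Phi> \<Delta> \<alpha>
    using assms(1) \<alpha> by unfold_locales
  have m': "m' > 0" using assms(3,5) by (cases m') auto
  have p: "p > 0" using assms(4) by (simp add: prime_gt_0_nat)
  show ?thesis
  proof (intro conjI impI)
    assume p2: "p = 2"
    have N_eq: "N \<Phi> \<Delta> m p = card {x \<in> weight_lattice \<Phi>. (\<forall>i\<in>{1..7}. 0 < x \<bullet> \<alpha> i) \<and> \<theta> \<bullet> x < real (p ^ i)}"
      unfolding assms(5) using m' p denominators_2[of m'] assms(6)
      by (intro N_eq_card_lattice_points) (simp_all add: p2)
    \<comment> \<open>The right side, including the grouping and the \<open>- 0\<close>, has the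
      shape that unfolding \<open>tuples_iff\<close> and \<open>rcong_2_iff\<close> produces in the
      goal, so that \<open>card_V\<close> fits.\<close>
    have iff: "V k b2 b3 b4 b5 b6 b7 \<in>
        {x \<in> weight_lattice \<Phi>. (\<forall>i\<in>{1..7}. 0 < x \<bullet> \<alpha> i) \<and> \<theta> \<bullet> x < real (p ^ i)} \<longleftrightarrow>
      (k \<in> \<int> \<and> ((\<forall>b\<in>{b2, b3, b4, b5, b6, b7}. b \<in> \<int>) \<or> (\<forall>b\<in>{b2, b3, b4, b5, b6, b7}. b - 1/2 \<in> \<int>))) \<and>
        b2 > b3 \<and> b3 > b4 \<and> b4 > b5 \<and> b5 > b6 \<and> b6 > \<bar>b7\<bar> \<and>
        k > b2 + b3 + b4 + b5 + b6 - b7 \<and> real (p ^ i) > k \<and>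
        (k + b2 + b3 + b4 + b5 + b6 - b7 - 0) / 2 \<in> \<int>"
      for k b2 b3 b4 b5 b6 b7
      unfolding mem_Collect_eq weight_lattice_V_iff weight_coordinates_iff alcove_V_iff diff_0_right
      by (rule iffI; elim conjE; intro conjI; assumption)
    show "N \<Phi> \<Delta> m p = card {(b1, b2, b3, b4, b5, b6, b7).
        (b1, b2, b3, b4, b5, b6, b7) \<in> tuples \<and>
        b2 > b3 \<and> b3 > b4 \<and> b4 > b5 \<and> b5 > b6 \<and> b6 > \<bar>b7\<bar> \<and>
        sqrt 2 * b1 > b2 + b3 + b4 + b5 + b6 - b7 \<and>
        real (p ^ i) > sqrt 2 * b1 \<and>
        [sqrt 2 * b1 + b2 + b3 + b4 + b5 + b6 - b7 = 0] (rmod 2)}"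
      unfolding N_eq tuples_iff rcong_2_iff by (rule card_V[OF iff])
  next
    assume p2: "p > 2"
    have N_eq: "N \<Phi> \<Delta> m p = card {x \<in> dual_lattice. (\<forall>i\<in>{1..7}. 0 < x \<bullet> \<alpha> i) \<and> \<theta> \<bullet> x < real (p ^ i)}"
      unfolding assms(5)
      using m' p denominators_odd_prime[OF assms(4) p2 assms(6)] dual_lattice_subset_weight_lattice
      by (intro N_eq_card_lattice_points) auto
    have iff: "V k b2 b3 b4 b5 b6 b7 \<in>
        {x \<in> dual_lattice. (\<forall>i\<in>{1..7}. 0 < x \<bullet> \<alpha> i) \<and> \<theta> \<bullet> x < real (p ^ i)} \<longleftrightarrow>
      (k \<in> \<int> \<and> ((\<forall>b\<in>{b2, b3, b4, b5, b6, b7}. b \<in> \<int>) \<or> (\<forall>b\<in>{b2, b3, b4, b5, b6, b7}. b - 1/2 \<in> \<int>))) \<and>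
        (\<forall>b\<in>{b2, b3, b4, b5, b6, b7}. (2 * b - k) / 2 \<in> \<int>) \<and>
        b2 > b3 \<and> b3 > b4 \<and> b4 > b5 \<and> b5 > b6 \<and> b6 > \<bar>b7\<bar> \<and>
        k > b2 + b3 + b4 + b5 + b6 - b7 \<and> real (p ^ i) > k \<and>
        (b2 + b3 + b4 + b5 + b6 + b7 - 0) / 2 \<in> \<int>"
      for k b2 b3 b4 b5 b6 b7
      unfolding mem_Collect_eq dual_lattice_V_iff root_coordinates_iff alcove_V_iff diff_0_right
      by (rule iffI; elim conjE; intro conjI; assumption)
    show "N \<Phi> \<Delta> m p = card {(b1, b2, b3, b4, b5, b6, b7).
        (b1, b2, b3, b4, b5, b6, b7) \<in> tuples \<and>
        (\<forall>b\<in>{b2, b3, b4, b5, b6, b7}. [2 * b = sqrt 2 * b1] (rmod 2)) \<and>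
        b2 > b3 \<and> b3 > b4 \<and> b4 > b5 \<and> b5 > b6 \<and> b6 > \<bar>b7\<bar> \<and>
        sqrt 2 * b1 > b2 + b3 + b4 + b5 + b6 - b7 \<and>
        real (p ^ i) > sqrt 2 * b1 \<and>
        [b2 + b3 + b4 + b5 + b6 + b7 = 0] (rmod 2)}"
      unfolding N_eq tuples_iff rcong_2_iff by (rule card_V[OF iff])
  qed
qed

end
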